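(* For all $d,N\in\mathbb{Z}_{++}$, $L\ge2$ and $\sigma^2>0$, if the data are generated by the deep neural network process, then for all $T\in\mathbb{Z}_{++}$, $$\mathcal{L}_T\le\frac{P}{2T}\Big(1+\ln\Big(1+\frac{2LT}{\sigma^2P}\Big)\Big),\qquad P=(L-2)N^2+N+dN.$$
   Context: Deep neural network process: the weight matrices $A^{(1)}\in\mathbb{R}^{N\times d}$, $A^{(\ell)}\in\mathbb{R}^{N\times N}$ for $2\le\ell\le L-1$, and $A^{(L)}\in\mathbb{R}^{1\times N}$ are mutually independent. All entries are i.i.d. centered Gaussian, with variance $1/d$ for $\ell=1$ and variance $1/N$ for $\ell\ge2$. The inputs $X_t$ are i.i.d. $\mathcal{N}(0,I_d)$. Set $U^{(0)}_t=X_t$ and $U^{(\ell)}_t=\mathrm{ReLU}(A^{(\ell)}U^{(\ell-1)}_t)$, with ReLU applied entrywise for $\ell=1,\ldots,L$. Labels are $Y_{t+1}=U^{(L)}_t+W_{t+1}$, where the $W_{t+1}$ are i.i.d. $\mathcal{N}(0,\sigma^2)$. Weights, inputs and noise are all independent. With $\theta=A^{(1:L)}$ and $H_t=(X_0,Y_1,\ldots,Y_t,X_t)$, the optimal estimation error is $$\mathcal{L}_T=\frac1T\sum_{t=0}^{T-1}\mathbb{E}\big[\mathrm{d}_{\mathrm{KL}}(\mathbb{P}(Y_{t+1}\in\cdot\mid\theta,H_t)\,\|\,\mathbb{P}(Y_{t+1}\in\cdot\mid H_t))\big].$$ *)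

theory Defs
  imports "HOL-Probability.Probability"
begin

text \<open>Weights theta are encoded as a function on index triples (l, i, j), meaning the
  (i,j) entry of the matrix A^(l); only the triples in dnn_index are used.
  Layer l (1 <= l <= L) has dnn_rows rows and dnn_cols columns.\<close>

definition dnn_rows :: "nat \<Rightarrow> nat \<Rightarrow> nat \<Rightarrow> nat" where
  "dnn_rows N L l = (if l = L then 1 else N)"

definition dnn_cols :: "nat \<Rightarrow> nat \<Rightarrow> nat \<Rightarrow> nat" where
  "dnn_cols d N l = (if l = 1 then d else N)"

definition dnn_index :: "nat \<Rightarrow> nat \<Rightarrow> nat \<Rightarrow> (nat \<times> nat \<times> nat) set" where
  "dnn_index d N L = {(l, i, j). 1 \<le> l \<and> l \<le> L \<and> i < dnn_rows N L l \<and> j < dnn_cols d N l}"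

definition relu :: "real \<Rightarrow> real" where
  "relu x = max 0 x"

text \<open>dnn_layer d N theta l x = U^(l) for input U^(0) = x (vectors as nat => real,
  the relevant coordinates being those below the layer width).\<close>
fun dnn_layer :: "nat \<Rightarrow> nat \<Rightarrow> (nat \<times> nat \<times> nat \<Rightarrow> real) \<Rightarrow> nat \<Rightarrow> (nat \<Rightarrow> real) \<Rightarrow> (nat \<Rightarrow> real)" where
  "dnn_layer d N \<theta> 0 x = x"
| "dnn_layer d N \<theta> (Suc l) x =
     (\<lambda>i. relu (\<Sum>j<dnn_cols d N (Suc l). \<theta> (Suc l, i, j) * dnn_layer d N \<theta> l x j))"

text \<open>The network output U^(L) (a scalar: the unique coordinate of the last layer).\<close>
definition dnn_out :: "nat \<Rightarrow> nat \<Rightarrow> nat \<Rightarrow> (nat \<times> nat \<times> nat \<Rightarrow> real) \<Rightarrow> (nat \<Rightarrow> real) \<Rightarrow> real" where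
  "dnn_out d N L \<theta> x = dnn_layer d N \<theta> L x 0"

definition gauss :: "real \<Rightarrow> real \<Rightarrow> real measure" where
  "gauss m v = density lborel (normal_density m (sqrt v))"

definition dnn_prior :: "nat \<Rightarrow> nat \<Rightarrow> nat \<Rightarrow> (nat \<times> nat \<times> nat \<Rightarrow> real) measure" where
  "dnn_prior d N L = PiM (dnn_index d N L)
     (\<lambda>(l, i, j). gauss 0 (if l = 1 then 1 / real d else 1 / real N))"

text \<open>Sample space: (weights, input sequence (X_t)_t, noise sequence (W_s)_s);
  each X_t is N(0, I_d), each W_s is N(0, sigma^2); all independent.\<close>
type_synonym dnn_omega = "(nat \<times> nat \<times> nat \<Rightarrow> real) \<times> (nat \<Rightarrow> nat \<Rightarrow> real) \<times> (nat \<Rightarrow> real)"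

definition dnn_space :: "nat \<Rightarrow> nat \<Rightarrow> nat \<Rightarrow> real \<Rightarrow> dnn_omega measure" where
  "dnn_space d N L s2 =
     dnn_prior d N L \<Otimes>\<^sub>M
     (PiM UNIV (\<lambda>_. PiM {..<d} (\<lambda>_. gauss 0 1)) \<Otimes>\<^sub>M PiM UNIV (\<lambda>_. gauss 0 s2))"

definition dnn_theta :: "dnn_omega \<Rightarrow> (nat \<times> nat \<times> nat \<Rightarrow> real)" where
  "dnn_theta \<omega> = fst \<omega>"

definition dnn_X :: "nat \<Rightarrow> dnn_omega \<Rightarrow> (nat \<Rightarrow> real)" where
  "dnn_X t \<omega> = fst (snd \<omega>) t"

definition dnn_W :: "nat \<Rightarrow> dnn_omega \<Rightarrow> real" where
  "dnn_W s \<omega> = snd (snd \<omega>) s"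

definition dnn_Y :: "nat \<Rightarrow> nat \<Rightarrow> nat \<Rightarrow> nat \<Rightarrow> dnn_omega \<Rightarrow> real" where
  "dnn_Y d N L s \<omega> = dnn_out d N L (dnn_theta \<omega>) (dnn_X (s - 1) \<omega>) + dnn_W s \<omega>"

text \<open>History H_t = (X_0, Y_1, ..., Y_t, X_t), encoded as (X restricted to {..t},
  Y restricted to {1..t}), with its measurable space.\<close>
type_synonym dnn_hist = "(nat \<Rightarrow> nat \<Rightarrow> real) \<times> (nat \<Rightarrow> real)"

definition dnn_H :: "nat \<Rightarrow> nat \<Rightarrow> nat \<Rightarrow> nat \<Rightarrow> dnn_omega \<Rightarrow> dnn_hist" where
  "dnn_H d N L t \<omega> = (restrict (\<lambda>s. dnn_X s \<omega>) {..t}, restrict (\<lambda>s. dnn_Y d N L s \<omega>) {1..t})"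

definition hist_space :: "nat \<Rightarrow> nat \<Rightarrow> dnn_hist measure" where
  "hist_space d t = PiM {..t} (\<lambda>_. PiM {..<d} (\<lambda>_. borel)) \<Otimes>\<^sub>M PiM {1..t} (\<lambda>_. borel)"

definition theta_space :: "nat \<Rightarrow> nat \<Rightarrow> nat \<Rightarrow> (nat \<times> nat \<times> nat \<Rightarrow> real) measure" where
  "theta_space d N L = PiM (dnn_index d N L) (\<lambda>_. borel)"

definition is_cond_distr ::
  "'w measure \<Rightarrow> 'z measure \<Rightarrow> ('w \<Rightarrow> 'z) \<Rightarrow> ('w \<Rightarrow> real) \<Rightarrow> ('z \<Rightarrow> real measure) \<Rightarrow> bool" where
  "is_cond_distr M S Z Y K \<longleftrightarrow>
     K \<in> S \<rightarrow>\<^sub>M prob_algebra borel \<and>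
     (\<forall>A\<in>sets S. \<forall>B\<in>sets borel.
        emeasure M {\<omega> \<in> space M. Z \<omega> \<in> A \<and> Y \<omega> \<in> B} =
        (\<integral>\<^sup>+ z\<in>A. emeasure (K z) B \<partial>(distr M S Z)))"

text \<open>Kullback-Leibler divergence d_KL(P || Q) in nats (library KL_divergence b Q P
  is the divergence of P with respect to Q).\<close>
definition dKL :: "real measure \<Rightarrow> real measure \<Rightarrow> real" where
  "dKL P Q = KL_divergence (exp 1) Q P"

end

theory Submission
  imports Defs
begin

text \<open>
  Write \<open>Z\<^sub>t\<close> for the prior integral of the Gaussian likelihood of
  \<open>Y\<^sub>1, \<dots>, Y\<^sub>t\<close> (up to the normalising constant). Regular conditional distributions on the line
  are almost surely unique, so the two predictive laws are \<open>N(U\<^sub>t, \<sigma>\<^sup>2)\<close> and the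
  density proportional to \<open>Z\<^sub>t\<^sub>+\<^sub>1 / Z\<^sub>t\<close>; the expected divergences telescope to
  \<open>- E ln Z\<^sub>T - T/2\<close>. To bound \<open>- ln Z\<^sub>T\<close>, substitute
  \<open>\<phi> = a \<theta> + b \<xi>\<close> with \<open>a\<^sup>2 + b\<^sup>2 = 1\<close> in the prior
  integral, \<open>\<theta>\<close> being the true weights and \<open>\<xi>\<close> an independent copy,
  and apply Jensen to the integral over \<open>\<xi>\<close>. The Jacobian costs \<open>- P ln b\<close>, the Gaussian
  weights cancel in expectation because \<open>\<phi>\<close> is again distributed as the prior, and the
  likelihood costs \<open>T/(2 \<sigma>\<^sup>2)\<close> times the mean squared distance between the networks with weights
  \<open>\<theta>\<close> and \<open>\<phi>\<close>. Since relu is 1-Lipschitz, each layer adds at most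
  \<open>2 (1 - a)\<close> to that distance. The choice
  \<open>b\<^sup>2 = 1 / (1 + 2 L T / (\<sigma>\<^sup>2 P))\<close> gives the bound.
\<close>

section \<open>Products of Gaussian measures\<close>

text \<open>The bound on -ln Z is the Gibbs variational inequality: a trial law Q of the weights
  gives at most the Q-mean of the negative log-likelihood plus the relative entropy of Q to the
  prior. Here Q is the Gaussian with means a \<theta> and variances b^2 v. The constraint a^2 + b^2
  = 1 serves twice: averaged over \<theta>, the relative entropy is exactly -P ln b, and the mixed
  network obeys the same second moment bounds as the true one, whereas an additive perturbation
  \<theta> + b \<xi> would inflate the preactivations by a factor 1 + b^2 at every layer. Since each
  weight variance is the reciprocal of the width below, moments do not grow with depth either, and
  the distortion is linear in L. The noise alone contributes T/2 to the mean negative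
  log-likelihood; this is the T/2 subtracted in the telescoped sum, so only the distortion and -P ln
  b survive. Telescoping needs ln Z to be integrable, which a general measurable regression function
  does not guarantee; it is extracted from the same variational bound. Elsewhere nonnegative
  integrals are preferred, so that second moments can be exchanged and summed freely.\<close>

lemma sets_gauss [simp, measurable_cong]: "sets (gauss m v) = sets borel"
  by (simp add: gauss_def)

lemma space_gauss [simp]: "space (gauss m v) = UNIV"
  by (simp add: gauss_def)

lemma measurable_gauss [simp]: "measurable M (gauss m v) = measurable M borel"
  by (rule measurable_cong_sets) auto

lemma prob_space_gauss: "v > 0 \<Longrightarrow> prob_space (gauss m v)"
  unfolding gauss_def by (rule prob_space_normal_density) simp

lemma nn_integral_gauss:
  fixes f :: "real \<Rightarrow> ennreal"
  assumes [measurable]: "f \<in> borel_measurable borel"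
  shows "(\<integral>\<^sup>+x. f x \<partial>gauss m v) = (\<integral>\<^sup>+x. normal_density m (sqrt v) x * f x \<partial>lborel)"
  unfolding gauss_def by (subst nn_integral_density) auto

text \<open>Substitution of \<open>c + b * x\<close> in the Lebesgue integral: the Jacobian is b,
  and the exponential is the ratio of the normal density at \<open>c + b * x\<close> to that at x.
  Having the same Gaussian on both sides lets the rule be tensorised.\<close>

lemma nn_integral_gauss_affine:
  fixes f :: "real \<Rightarrow> ennreal"
  assumes [measurable]: "f \<in> borel_measurable borel" and "v > 0" "b > 0"
  shows "(\<integral>\<^sup>+x. f x \<partial>gauss 0 v) =
    (\<integral>\<^sup>+x. ennreal (b * exp ((x\<^sup>2 - (c + b * x)\<^sup>2) / (2 * v))) * f (c + b * x) \<partial>gauss 0 v)"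
proof -
  have "(\<integral>\<^sup>+x. f x \<partial>gauss 0 v) =
      (\<integral>\<^sup>+x. b * (normal_density 0 (sqrt v) (c + b * x) * f (c + b * x)) \<partial>lborel)"
    using assms(3)
    by (subst nn_integral_gauss, simp, subst nn_integral_real_affine[where c=b and t=c])
       (auto simp: nn_integral_cmult)
  also have "\<dots> = (\<integral>\<^sup>+x. normal_density 0 (sqrt v) x *
      (ennreal (b * exp ((x\<^sup>2 - (c + b * x)\<^sup>2) / (2 * v))) * f (c + b * x)) \<partial>lborel)"
  proof (rule nn_integral_cong)
    fix x
    have "b * normal_density 0 (sqrt v) (c + b * x) =
        normal_density 0 (sqrt v) x * (b * exp ((x\<^sup>2 - (c + b * x)\<^sup>2) / (2 * v)))"
        (is "_ = _ * (b * ?e)")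
      using assms unfolding normal_density_def
      by (simp add: exp_add [symmetric] diff_divide_distrib)
    then show "ennreal b * (ennreal (normal_density 0 (sqrt v) (c + b * x)) * f (c + b * x)) =
        normal_density 0 (sqrt v) x *
        (ennreal (b * exp ((x\<^sup>2 - (c + b * x)\<^sup>2) / (2 * v))) * f (c + b * x))"
      using assms by (simp only: mult.assoc[symmetric] ennreal_mult'[symmetric] normal_density_nonneg
        less_imp_le)
  qed
  also have "\<dots> = (\<integral>\<^sup>+x. ennreal (b * exp ((x\<^sup>2 - (c + b * x)\<^sup>2) / (2 * v))) * f (c + b * x) \<partial>gauss 0 v)"
    by (subst nn_integral_gauss) auto
  finally show ?thesis .
qed

lemma nn_integral_gauss_shift:
  fixes f :: "real \<Rightarrow> ennreal"
  assumes [measurable]: "f \<in> borel_measurable borel"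
  shows "(\<integral>\<^sup>+x. f x \<partial>gauss m v) = (\<integral>\<^sup>+x. f (m + x) \<partial>gauss 0 v)"
  by (simp add: nn_integral_gauss, subst nn_integral_real_affine[where c=1 and t=m])
     (auto simp: normal_density_def)

text \<open>The odd moment removes the cross term. Stated in \<open>ennreal\<close> so that it
  applies inside further integrals, with A and B depending on other coordinates, free of
  integrability conditions.\<close>

lemma nn_integral_gauss_square:
  assumes "v > 0"
  shows "(\<integral>\<^sup>+w. ennreal ((B + w * A)\<^sup>2) \<partial>gauss 0 v) = ennreal (B\<^sup>2) + ennreal v * ennreal (A\<^sup>2)"
proof -
  let ?n = "normal_density 0 (sqrt v)"
  have s: "0 < sqrt v" using assms by simp
  have "has_bochner_integral lborel (\<lambda>x. ?n x * (x - 0) ^ (2 * 0)) 1"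
    "has_bochner_integral lborel (\<lambda>x. ?n x * (x - 0) ^ (2 * 0 + 1)) 0"
    "has_bochner_integral lborel (\<lambda>x. ?n x * (x - 0) ^ (2 * 1)) v"
    using normal_moment_even[OF s, of 0 0] normal_moment_odd[OF s, of 0 0]
      normal_moment_even[OF s, of 0 1] assms by (simp_all add: power2_eq_square)
  then have "has_bochner_integral lborel (\<lambda>x. B\<^sup>2 * (?n x * (x - 0) ^ (2 * 0))
      + (2 * A * B) * (?n x * (x - 0) ^ (2 * 0 + 1)) + A\<^sup>2 * (?n x * (x - 0) ^ (2 * 1)))
      (B\<^sup>2 * 1 + (2 * A * B) * 0 + A\<^sup>2 * v)"
    by (intro has_bochner_integral_add has_bochner_integral_mult_right)
  moreover have "(\<lambda>x. B\<^sup>2 * (?n x * (x - 0) ^ (2 * 0))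
      + (2 * A * B) * (?n x * (x - 0) ^ (2 * 0 + 1)) + A\<^sup>2 * (?n x * (x - 0) ^ (2 * 1))) =
      (\<lambda>x. ?n x * (B + x * A)\<^sup>2)"
    by (simp add: fun_eq_iff power2_eq_square algebra_simps)
  ultimately have *: "has_bochner_integral lborel (\<lambda>x. ?n x * (B + x * A)\<^sup>2) (B\<^sup>2 + v * A\<^sup>2)"
    by (simp add: mult.commute)
  have "(\<integral>\<^sup>+w. ennreal ((B + w * A)\<^sup>2) \<partial>gauss 0 v) = (\<integral>\<^sup>+x. ennreal (?n x * (B + x * A)\<^sup>2) \<partial>lborel)"
    by (subst nn_integral_gauss) (auto simp: ennreal_mult')
  also have "\<dots> = ennreal (B\<^sup>2 + v * A\<^sup>2)"
    using assms by (simp add: nn_integral_eq_integral[OF integrable.intros[OF *]]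
        has_bochner_integral_integral_eq[OF *])
  finally show ?thesis using assms by (simp add: ennreal_plus ennreal_mult')
qed

text \<open>Positivity is asked at every index, also outside I, since
  \<open>product_prob_space\<close> takes a probability measure at each index.\<close>

locale gauss_family =
  fixes I :: "'i set" and v :: "'i \<Rightarrow> real"
  assumes finite_I [simp]: "finite I" and v_pos: "v i > 0"
begin

sublocale product_prob_space "\<lambda>i. gauss 0 (v i)" I
  by (rule product_prob_spaceI) (rule prob_space_gauss[OF v_pos])

abbreviation GP :: "('i \<Rightarrow> real) measure" where
  "GP \<equiv> PiM I (\<lambda>i. gauss 0 (v i))"

text \<open>Used twice: with b = 1 it passes from noise to labels, and with
  \<open>c i = a * \<theta> i\<close> it performs the substitution in the prior integral.\<close>

lemma nn_integral_GP_affine: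
  assumes F [measurable]: "F \<in> borel_measurable GP" and b: "b > 0"
  shows "(\<integral>\<^sup>+x. F x \<partial>GP) =
    (\<integral>\<^sup>+x. ennreal (\<Prod>i\<in>I. b * exp (((x i)\<^sup>2 - (c i + b * x i)\<^sup>2) / (2 * v i))) *
        F (\<lambda>i\<in>I. c i + b * x i) \<partial>GP)"
proof -
  let ?w = "\<lambda>i x. b * exp ((x\<^sup>2 - (c i + b * x)\<^sup>2) / (2 * v i))"
  let ?D = "density GP (\<lambda>x. ennreal (\<Prod>i\<in>I. ?w i (x i)))"
  let ?T = "\<lambda>x. \<lambda>i\<in>I. c i + b * x i"
  have [measurable]: "(\<lambda>x. \<Prod>i\<in>I. ?w i (x i)) \<in> borel_measurable GP" by measurable
  have T [measurable]: "?T \<in> measurable GP GP" by measurable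
  \<comment> \<open>A product measure is determined by its values on boxes, and on a box the
    weighted integral factorises into one-dimensional instances of the rule.\<close>
  have "distr ?D GP ?T = GP"
  proof (rule PiM_eqI)
    fix A assume A: "\<And>i. i \<in> I \<Longrightarrow> A i \<in> sets (gauss 0 (v i))"
    then have [measurable]: "Pi\<^sub>E I A \<in> sets GP" by auto
    have "emeasure (distr ?D GP ?T) (Pi\<^sub>E I A) =
        (\<integral>\<^sup>+x. ennreal (\<Prod>i\<in>I. ?w i (x i)) * indicator (Pi\<^sub>E I A) (?T x) \<partial>GP)"
    proof -
      have "?T -` Pi\<^sub>E I A \<inter> space ?D \<in> sets GP"
        using measurable_sets[OF T, of "Pi\<^sub>E I A"] by simp
      moreover have "indicator (?T -` Pi\<^sub>E I A \<inter> space ?D) x = (indicator (Pi\<^sub>E I A) (?T x) :: ennreal)"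
        if "x \<in> space GP" for x using that by (simp only: indicator_def vimage_eq Int_iff space_density simp_thms)
      ultimately show ?thesis
        by (simp add: emeasure_distr emeasure_density cong: nn_integral_cong)
    qed
    also have "\<dots> = (\<integral>\<^sup>+x. (\<Prod>i\<in>I. ennreal (?w i (x i)) * indicator (A i) (c i + b * x i)) \<partial>GP)"
    proof (rule nn_integral_cong)
      fix x
      have "indicator (Pi\<^sub>E I A) (?T x) = (\<Prod>i\<in>I. indicator (A i) (c i + b * x i) :: ennreal)"
      proof (cases "\<forall>i\<in>I. c i + b * x i \<in> A i")
        case True
        then have "?T x \<in> Pi\<^sub>E I A" by auto
        with True show ?thesis by simp
      next
        case False
        then have "?T x \<notin> Pi\<^sub>E I A" by (auto simp: PiE_iff)
        moreover obtain i where "i \<in> I" "c i + b * x i \<notin> A i" using False by auto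
        ultimately show ?thesis by (subst prod_zero) (auto intro: bexI[of _ i])
      qed
      then show "ennreal (\<Prod>i\<in>I. ?w i (x i)) * indicator (Pi\<^sub>E I A) (?T x) =
          (\<Prod>i\<in>I. ennreal (?w i (x i)) * indicator (A i) (c i + b * x i))"
        using b by (simp only: prod.distrib[of "\<lambda>i. ennreal (?w i (x i))"]) (subst prod_ennreal, auto)
    qed
    also have "\<dots> = (\<Prod>i\<in>I. \<integral>\<^sup>+x. ennreal (?w i x) * indicator (A i) (c i + b * x) \<partial>gauss 0 (v i))"
    proof (rule product_nn_integral_prod[OF finite_I])
      fix i assume "i \<in> I"
      then have [measurable]: "A i \<in> sets borel" using A by auto
      show "(\<lambda>x. ennreal (?w i x) * indicator (A i) (c i + b * x)) \<in> borel_measurable (gauss 0 (v i))"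
        by measurable
    qed
    also have "\<dots> = (\<Prod>i\<in>I. emeasure (gauss 0 (v i)) (A i))"
    proof (rule prod.cong[OF refl])
      fix i assume "i \<in> I"
      then have Ai [measurable]: "A i \<in> sets borel" using A by auto
      show "(\<integral>\<^sup>+x. ennreal (?w i x) * indicator (A i) (c i + b * x) \<partial>gauss 0 (v i)) =
          emeasure (gauss 0 (v i)) (A i)"
        using nn_integral_gauss_affine[of "indicator (A i)" "v i" b "c i"] v_pos b Ai by simp
    qed
    finally show "emeasure (distr ?D GP ?T) (Pi\<^sub>E I A) = (\<Prod>i\<in>I. emeasure (gauss 0 (v i)) (A i))" .
  qed simp_all
  then have "(\<integral>\<^sup>+x. F x \<partial>GP) = (\<integral>\<^sup>+x. F x \<partial>distr ?D GP ?T)" by simp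
  also have "\<dots> = (\<integral>\<^sup>+x. ennreal (\<Prod>i\<in>I. ?w i (x i)) * F (?T x) \<partial>GP)"
    by (subst nn_integral_distr, simp, simp, subst nn_integral_density) auto
  finally show ?thesis .
qed

text \<open>Invariance under \<open>x(k := y)\<close> encodes that A and B are independent of
  coordinate k. That coordinate is integrated first; being centred, it leaves no cross term.\<close>

lemma nn_integral_GP_square_add:
  assumes A [measurable]: "A \<in> borel_measurable GP" and B [measurable]: "B \<in> borel_measurable GP"
    and k: "k \<in> I" and ind: "\<And>x y. A (x(k := y)) = A x" "\<And>x y. B (x(k := y)) = B x"
  shows "(\<integral>\<^sup>+x. ennreal ((B x + x k * A x)\<^sup>2) \<partial>GP) =
    (\<integral>\<^sup>+x. ennreal ((B x)\<^sup>2) \<partial>GP) + ennreal (v k) * (\<integral>\<^sup>+x. ennreal ((A x)\<^sup>2) \<partial>GP)"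
proof -
  have I: "I = insert k (I - {k})" using k by auto
  have split: "(\<integral>\<^sup>+x. F x \<partial>GP) =
      (\<integral>\<^sup>+x. (\<integral>\<^sup>+y. F (x(k := y)) \<partial>gauss 0 (v k)) \<partial>PiM (I - {k}) (\<lambda>i. gauss 0 (v i)))"
    if "F \<in> borel_measurable GP" for F :: "_ \<Rightarrow> ennreal"
    using product_nn_integral_insert[of "I - {k}" k F] that by (simp add: insert_absorb[OF k])
  have G: "GP = PiM (insert k (I - {k})) (\<lambda>i. gauss 0 (v i))" using I by metis
  have upd [measurable]: "(\<lambda>x. x(k := 0)) \<in> measurable (PiM (I - {k}) (\<lambda>i. gauss 0 (v i))) GP"
    unfolding G by (rule measurable_fun_upd[where J = "I - {k}"]) auto
  \<comment> \<open>C is measurable on the full product. Composing with \<open>x(k := 0)\<close>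
    carries this to the product without k, and as C ignores coordinate k the composite is C
    itself.\<close>
  have m: "(\<lambda>x. ennreal ((C x)\<^sup>2)) \<in> borel_measurable (PiM (I - {k}) (\<lambda>i. gauss 0 (v i)))"
    if [measurable]: "C \<in> borel_measurable GP" and ind: "\<And>x y. C (x(k := y)) = C x" for C :: "_ \<Rightarrow> real"
  proof -
    have "(\<lambda>x. ennreal ((C (x(k := 0)))\<^sup>2)) \<in> borel_measurable (PiM (I - {k}) (\<lambda>i. gauss 0 (v i)))"
      by measurable
    then show ?thesis by (simp add: ind)
  qed
  note [measurable] = m[OF A ind(1)] m[OF B ind(2)]
  have [measurable]: "(\<lambda>x. x k) \<in> borel_measurable GP"
    using measurable_component_singleton[OF k, of "\<lambda>i. gauss 0 (v i)"] by simp
  have *: "(\<integral>\<^sup>+x. ennreal ((B x)\<^sup>2) + ennreal (v k) *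
      ennreal ((A x)\<^sup>2) \<partial>PiM (I - {k}) (\<lambda>i. gauss 0 (v i))) =
    (\<integral>\<^sup>+x. ennreal ((B x)\<^sup>2) \<partial>PiM (I - {k}) (\<lambda>i. gauss 0 (v i))) +
    ennreal (v k) * (\<integral>\<^sup>+x. ennreal ((A x)\<^sup>2) \<partial>PiM (I - {k}) (\<lambda>i. gauss 0 (v i)))"
    using m[OF A ind(1)] m[OF B ind(2)] by (simp only: nn_integral_add nn_integral_cmult
      borel_measurable_times_ennreal borel_measurable_const)
  show ?thesis
    by (simp add: split ind * nn_integral_gauss_square v_pos nn_integral_add nn_integral_cmult
      prob_space.emeasure_space_1[OF prob_space_gauss[OF v_pos], simplified])
qed

text \<open>Pythagoras for a random row: the weights in J are centred, mutually independent and, by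
  the invariance premises, independent of every \<open>A j\<close> and of B, so they are peeled off
  one at a time. Later J is a row of a weight matrix and A holds the activations it acts on.\<close>

lemma nn_integral_GP_square_row:
  assumes J: "finite J" "J \<subseteq> I"
    and A: "\<And>j. j \<in> J \<Longrightarrow> A j \<in> borel_measurable GP" and B [measurable]: "B \<in> borel_measurable GP"
    and indA: "\<And>j k x y. j \<in> J \<Longrightarrow> k \<in> J \<Longrightarrow> A j (x(k := y)) = A j x"
    and indB: "\<And>k x y. k \<in> J \<Longrightarrow> B (x(k := y)) = B x"
  shows "(\<integral>\<^sup>+x. ennreal ((B x + (\<Sum>j\<in>J. x j * A j x))\<^sup>2) \<partial>GP) =
    (\<integral>\<^sup>+x. ennreal ((B x)\<^sup>2) \<partial>GP) + (\<Sum>j\<in>J. ennreal (v j) * (\<integral>\<^sup>+x. ennreal ((A j x)\<^sup>2) \<partial>GP))"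
  using assms
proof (induction J)
  case (insert k J)
  note [measurable] = insert.prems(2)
  have [measurable]: "(\<lambda>x. x j) \<in> borel_measurable GP" if "j \<in> J" for j
    using measurable_component_singleton[of j I "\<lambda>i. gauss 0 (v i)"] that insert.prems by auto
  have "(\<integral>\<^sup>+x. ennreal ((B x + (\<Sum>j\<in>insert k J. x j * A j x))\<^sup>2) \<partial>GP) =
     (\<integral>\<^sup>+x. ennreal (((B x + (\<Sum>j\<in>J. x j * A j x)) + x k * A k x)\<^sup>2) \<partial>GP)"
    using insert.hyps by (simp add: add_ac)
  also have "\<dots> = (\<integral>\<^sup>+x. ennreal ((B x + (\<Sum>j\<in>J. x j * A j x))\<^sup>2) \<partial>GP) +
      ennreal (v k) * (\<integral>\<^sup>+x. ennreal ((A k x)\<^sup>2) \<partial>GP)"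
  proof (rule nn_integral_GP_square_add)
    show "B (x(k := y)) + (\<Sum>j\<in>J. (x(k := y)) j * A j (x(k := y))) = B x + (\<Sum>j\<in>J. x j * A j x)" for x y
    proof -
      have "(\<Sum>j\<in>J. (x(k := y)) j * A j (x(k := y))) = (\<Sum>j\<in>J. x j * A j x)"
      proof (intro sum.cong refl arg_cong2[where f="(*)"])
        fix j assume j: "j \<in> J"
        then show "(x(k := y)) j = x j" using insert.hyps by auto
        show "A j (x(k := y)) = A j x" using j by (intro insert.prems(4)) auto
      qed
      then show ?thesis by (simp only: insert.prems(5)[OF insertI1])
    qed
    show "A k (x(k := y)) = A k x" for x y by (rule insert.prems(4)) auto
  qed (use insert.prems(1-3) in auto)
  also have "(\<integral>\<^sup>+x. ennreal ((B x + (\<Sum>j\<in>J. x j * A j x))\<^sup>2) \<partial>GP) = 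
     (\<integral>\<^sup>+x. ennreal ((B x)\<^sup>2) \<partial>GP) + (\<Sum>j\<in>J. ennreal (v j) * (\<integral>\<^sup>+x. ennreal ((A j x)\<^sup>2) \<partial>GP))"
    by (rule insert.IH) (use insert.prems in auto)
  finally show ?case using insert.hyps by (simp add: add_ac)
qed simp

end

section \<open>Bayesian regression with Gaussian noise\<close>

text \<open>The rays have rational endpoints to make the generator countable: identities that hold
  almost surely for each ray then hold for all of them off a single null set.\<close>

lemma real_measure_eqI_rat:
  fixes M N :: "real measure"
  assumes sets: "sets M = sets borel" "sets N = sets borel" and "finite_measure M"
    and eq: "\<And>q::rat. emeasure M {of_rat q <..} = emeasure N {of_rat q <..}"
  shows "M = N"
proof (rule measure_eqI_generator_eq_countable)
  interpret finite_measure M by fact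
  let ?LT = "\<lambda>q::rat. {real_of_rat q <..}" let ?E = "range ?LT"
  show "Int_stable ?E"
  proof (rule Int_stableI)
    fix a b assume "a \<in> ?E" "b \<in> ?E"
    then obtain p q where "a = ?LT p" "b = ?LT q" by auto
    then have "a \<inter> b = ?LT (max p q)"
      using of_rat_less_eq[of p q, where ?'a=real] by (cases "p \<le> q") (auto simp: max_def)
    then show "a \<inter> b \<in> ?E" by auto
  qed
  have b: "borel = sigma UNIV ?E"
  proof (rule borel_eq_sigmaI1[where X="range (greaterThan :: real \<Rightarrow> _)"])
    show "borel = sigma UNIV (range (greaterThan :: real \<Rightarrow> _))"
      by (rule measure_eqI) (auto simp: borel_Ioi emeasure_sigma borel_def)
    fix x assume "x \<in> range (greaterThan :: real \<Rightarrow> _)"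
    then obtain a where x: "x = {a<..}" by auto
    have "x = (\<Union>q\<in>{q. a < real_of_rat q}. ?LT q)"
      unfolding x
    proof (intro equalityI subsetI)
      fix y assume "y \<in> {a<..}"
      then obtain q where "a < real_of_rat q" "real_of_rat q < y"
        using of_rat_dense[of a y] by auto
      then show "y \<in> (\<Union>q\<in>{q. a < real_of_rat q}. ?LT q)" by auto
    qed auto
    also have "\<dots> \<in> sets (sigma UNIV ?E)"
      by (rule sets.countable_UN'') auto
    finally show "x \<in> sets (sigma UNIV ?E)" .
  qed auto
  show "?E \<subseteq> Pow UNIV" by auto
  show "sets M = sigma_sets UNIV ?E" "sets N = sigma_sets UNIV ?E"
    unfolding sets by (subst b, simp)+
  have "x \<in> (\<Union>q. ?LT q)" for x
    using of_rat_dense[of "x - 1" x] by auto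
  then show "(\<Union>q. ?LT q) = UNIV" by auto
  show "countable ?E" by auto
qed (auto simp: eq finite_measure.emeasure_finite[OF \<open>finite_measure M\<close>])

text \<open>For fixed B both masses are densities, with respect to the law of Z, of the measure
  sending A to P(Z in A, Y in B), hence agree almost surely. The exceptional set depends on B;
  restricting to rational rays makes it uniform.\<close>

lemma AE_is_cond_distr_unique:
  assumes M: "prob_space M" and Z: "Z \<in> measurable M S"
    and K: "is_cond_distr M S Z Y K" and K': "is_cond_distr M S Z Y K'"
  shows "AE z in distr M S Z. K z = K' z"
proof -
  interpret prob_space "distr M S Z" by (rule prob_space.prob_space_distr[OF M Z])
  have Kp: "K \<in> S \<rightarrow>\<^sub>M prob_algebra borel" "K' \<in> S \<rightarrow>\<^sub>M prob_algebra borel"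
    using K K' by (simp_all add: is_cond_distr_def)
  have m: "(\<lambda>z. emeasure (K z) B) \<in> borel_measurable S" "(\<lambda>z. emeasure (K' z) B) \<in> borel_measurable S"
    if "B \<in> sets borel" for B
    using measurable_emeasure_kernel[OF measurable_prob_algebraD that] Kp by blast+
  have "AE z in distr M S Z. emeasure (K z) B = emeasure (K' z) B" if B: "B \<in> sets borel" for B
  proof (rule density_unique_finite_measure)
    fix A assume A: "A \<in> sets (distr M S Z)"
    have "emeasure M {\<omega> \<in> space M. Z \<omega> \<in> A \<and> Y \<omega> \<in> B} =
        (\<integral>\<^sup>+z\<in>A. emeasure (J z) B \<partial>distr M S Z)" if "is_cond_distr M S Z Y J" for J
      using that A B unfolding is_cond_distr_def sets_distr by blast
    from trans[OF sym[OF this[OF K]] this[OF K']]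
    show "(\<integral>\<^sup>+z. emeasure (K z) B * indicator A z \<partial>distr M S Z) =
        (\<integral>\<^sup>+z. emeasure (K' z) B * indicator A z \<partial>distr M S Z)" .
  qed (use m[OF B] in \<open>simp_all\<close>)
  then have "AE z in distr M S Z. \<forall>q::rat. emeasure (K z) {of_rat q <..} =
      emeasure (K' z) {of_rat q <..}"
    by (subst AE_all_countable) auto
  with AE_space show ?thesis
  proof eventually_elim
    fix z assume z: "z \<in> space (distr M S Z)"
      and eq: "\<forall>q::rat. emeasure (K z) {of_rat q <..} = emeasure (K' z) {of_rat q <..}"
    have "K z \<in> space (prob_algebra borel)" "K' z \<in> space (prob_algebra borel)"
      using z by (auto intro!: measurable_space[OF Kp(1)] measurable_space[OF Kp(2)])
    then show "K z = K' z"
      using eq by (intro real_measure_eqI_rat) (auto simp: space_prob_algebra prob_space_def)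
  qed
qed

section \<open>Regression model, likelihood and its prior integral\<close>

locale gaussian_regression =
  fixes P :: "'p measure" and XM :: "'x measure" and f :: "'p \<Rightarrow> 'x \<Rightarrow> real" and s2 :: real
  assumes prob_P: "prob_space P" and prob_XM: "prob_space XM"
    and f: "(\<lambda>(\<theta>, x). f \<theta> x) \<in> borel_measurable (P \<Otimes>\<^sub>M XM)" and s2: "s2 > 0"
begin

sublocale P: prob_space P by (rule prob_P)
sublocale XM: prob_space XM by (rule prob_XM)
sublocale W: prob_space "gauss 0 s2" by (rule prob_space_gauss[OF s2])
sublocale XP: product_prob_space "\<lambda>_. XM" I for I
  by (rule product_prob_spaceI) (rule prob_XM)
sublocale WP: product_prob_space "\<lambda>_. gauss 0 s2" I for I
  by (rule product_prob_spaceI) (rule prob_space_gauss[OF s2])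

lemma f_measurable [measurable (raw)]:
  assumes [measurable]: "g \<in> measurable M P" "k \<in> measurable M XM"
  shows "(\<lambda>w. f (g w) (k w)) \<in> borel_measurable M"
  using measurable_compose[OF _ f, of "\<lambda>w. (g w, k w)" M] by simp

abbreviation Xs where "Xs \<equiv> PiM (UNIV :: nat set) (\<lambda>_. XM)"
abbreviation Ws where "Ws \<equiv> PiM (UNIV :: nat set) (\<lambda>_. gauss 0 s2)"
abbreviation Om where "Om \<equiv> P \<Otimes>\<^sub>M (Xs \<Otimes>\<^sub>M Ws)"

sublocale XW: pair_prob_space Xs Ws ..
sublocale Om: pair_prob_space P "Xs \<Otimes>\<^sub>M Ws" ..

text \<open>Inputs and labels have separate horizons: when Y_{t+1} is predicted, a candidate label t
  + 1 is appended while X_{t+1} is not yet known, which leads to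
  \<open>XY t (Suc t)\<close>.\<close>

abbreviation XY :: "nat \<Rightarrow> nat \<Rightarrow> ((nat \<Rightarrow> 'x) \<times> (nat \<Rightarrow> real)) measure" where
  "XY t u \<equiv> PiM {..t} (\<lambda>_. XM) \<Otimes>\<^sub>M PiM {Suc 0..u} (\<lambda>_. borel)"
abbreviation HS where "HS t \<equiv> XY t t"

definition Y :: "nat \<Rightarrow> 'p \<times> (nat \<Rightarrow> 'x) \<times> (nat \<Rightarrow> real) \<Rightarrow> real" where
  "Y s \<omega> = f (fst \<omega>) (fst (snd \<omega>) (s - 1)) + snd (snd \<omega>) s"

definition H :: "nat \<Rightarrow> 'p \<times> (nat \<Rightarrow> 'x) \<times> (nat \<Rightarrow> real) \<Rightarrow> (nat \<Rightarrow> 'x) \<times> (nat \<Rightarrow> real)" where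
  "H t \<omega> = (restrict (fst (snd \<omega>)) {..t}, restrict (\<lambda>s. Y s \<omega>) {Suc 0..t})"

text \<open>The negative log-likelihood of the first t labels without its normalising constant;
  label s belongs to input s - 1.\<close>

definition G :: "nat \<Rightarrow> 'p \<Rightarrow> (nat \<Rightarrow> 'x) \<times> (nat \<Rightarrow> real) \<Rightarrow> real" where
  "G t \<theta> h = (\<Sum>s=Suc 0..t. (snd h s - f \<theta> (fst h (s - 1)))\<^sup>2 / (2 * s2))"

definition Z :: "nat \<Rightarrow> (nat \<Rightarrow> 'x) \<times> (nat \<Rightarrow> real) \<Rightarrow> real" where
  "Z t h = (\<integral>\<theta>. exp (- G t \<theta> h) \<partial>P)"

abbreviation R :: "nat \<Rightarrow> ((nat \<Rightarrow> 'x) \<times> (nat \<Rightarrow> real)) measure" where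
  "R t \<equiv> PiM {..t} (\<lambda>_. XM) \<Otimes>\<^sub>M PiM {Suc 0..t} (\<lambda>_. gauss 0 s2)"

lemma G_nonneg: "G t \<theta> h \<ge> 0"
  using s2 by (auto simp: G_def intro!: sum_nonneg)

lemma G_Suc: "G (Suc t) \<theta> h = G t \<theta> h + (snd h (Suc t) - f \<theta> (fst h t))\<^sup>2 / (2 * s2)"
  by (simp add: G_def)

text \<open>Inputs are compared strictly below t because the last input of \<open>H t\<close> has no
  label yet. Hence a history extended by a label alone already determines the next
  likelihood.\<close>

lemma G_cong:
  assumes "\<And>s. s < t \<Longrightarrow> fst h s = fst h' s" "\<And>s. 1 \<le> s \<Longrightarrow> s \<le> t \<Longrightarrow> snd h s = snd h' s"
  shows "G t \<theta> h = G t \<theta> h'"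
  unfolding G_def using assms by (intro sum.cong refl) auto

lemma Z_cong:
  assumes "\<And>s. s < t \<Longrightarrow> fst h s = fst h' s" "\<And>s. 1 \<le> s \<Longrightarrow> s \<le> t \<Longrightarrow> snd h s = snd h' s"
  shows "Z t h = Z t h'"
  unfolding Z_def by (simp only: G_cong[OF assms])

lemma measurable_G [measurable]:
  assumes "t \<le> u" "t \<le> Suc v"
  shows "(\<lambda>(\<theta>, h). G t \<theta> h) \<in> borel_measurable (P \<Otimes>\<^sub>M XY v u)"
proof -
  have "(\<lambda>(\<theta>, h). \<Sum>s=Suc 0..t. (snd h s - f \<theta> (fst h (s - 1)))\<^sup>2 / (2 * s2)) \<in>
      borel_measurable (P \<Otimes>\<^sub>M XY v u)"
    unfolding case_prod_beta
  proof (intro borel_measurable_sum)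
    fix s assume s: "s \<in> {Suc 0..t}"
    have [measurable]: "(\<lambda>x. x s) \<in> PiM {Suc 0..u} (\<lambda>_. borel) \<rightarrow>\<^sub>M (borel :: real measure)"
      "(\<lambda>x. x (s - 1)) \<in> PiM {..v} (\<lambda>_. XM) \<rightarrow>\<^sub>M XM"
      using s assms by (auto intro!: measurable_component_singleton)
    show "(\<lambda>x. (snd (snd x) s - f (fst x) (fst (snd x) (s - 1)))\<^sup>2 / (2 * s2)) \<in>
        borel_measurable (P \<Otimes>\<^sub>M XY v u)" by measurable
  qed
  then show ?thesis by (simp add: G_def)
qed

lemma measurable_exp_G:
  assumes "t \<le> u" "t \<le> Suc v" and h: "h \<in> space (XY v u)"
  shows "(\<lambda>\<theta>. exp (- G t \<theta> h)) \<in> borel_measurable P"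
proof -
  have [measurable]: "(\<lambda>\<theta>. G t \<theta> h) \<in> borel_measurable P"
    using measurable_compose[OF measurable_Pair2'[OF h] measurable_G[OF assms(1,2)]] by simp
  show ?thesis by measurable
qed

lemma measurable_Z [measurable]:
  assumes "t \<le> u" "t \<le> Suc v"
  shows "Z t \<in> borel_measurable (XY v u)"
proof -
  have [measurable]: "(\<lambda>x. G t (snd x) (fst x)) \<in> borel_measurable (XY v u \<Otimes>\<^sub>M P)"
    using measurable_compose[OF measurable_pair_swap' measurable_G[OF assms]]
    by (simp add: case_prod_beta)
  have "(\<lambda>(h, \<theta>). exp (- G t \<theta> h)) \<in> borel_measurable (XY v u \<Otimes>\<^sub>M P)"
    unfolding case_prod_beta by measurable
  from P.borel_measurable_lebesgue_integral[OF this] show ?thesis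
    unfolding Z_def .
qed

text \<open>Without the normalising constant the likelihood is at most 1; the resulting
  \<open>ln (Z t h) \<le> 0\<close> is later one side of the sandwich that makes the logarithm
  integrable.\<close>

lemma
  assumes "t \<le> u" "t \<le> Suc v" and h: "h \<in> space (XY v u)"
  shows Z_pos: "Z t h > 0" and Z_le_1: "Z t h \<le> 1"
    and nn_integral_exp_G: "(\<integral>\<^sup>+\<theta>. ennreal (exp (- G t \<theta> h)) \<partial>P) = ennreal (Z t h)"
proof -
  note [measurable] = measurable_exp_G[OF assms]
  have i: "integrable P (\<lambda>\<theta>. exp (- G t \<theta> h))"
    by (rule P.integrable_const_bound[where B=1]) (auto simp: G_nonneg)
  show "Z t h > 0"
    using P.integral_less_AE_space[OF integrable_zero i] P.emeasure_space_1 by (simp add: Z_def)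
  show "Z t h \<le> 1" unfolding Z_def
    by (rule P.integral_le_const[OF i]) (auto simp: G_nonneg)
  show "(\<integral>\<^sup>+\<theta>. ennreal (exp (- G t \<theta> h)) \<partial>P) = ennreal (Z t h)"
    unfolding Z_def by (rule nn_integral_eq_integral[OF i]) auto
qed

lemma measurable_Y [measurable]: "Y s \<in> borel_measurable Om"
  unfolding Y_def by measurable

lemma measurable_H [measurable]: "H t \<in> Om \<rightarrow>\<^sub>M HS t"
  unfolding H_def by measurable

text \<open>The reference law of a history is \<open>R t\<close>, under which the labels are pure noise; the joint
  law of parameter and history has density \<open>exp (- G) * E\<close> with respect to prior times \<open>R t\<close>.\<close>
definition E :: "nat \<Rightarrow> (nat \<Rightarrow> 'x) \<times> (nat \<Rightarrow> real) \<Rightarrow> real" where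
  "E t h = exp (\<Sum>s=Suc 0..t. (snd h s)\<^sup>2 / (2 * s2))"

lemma measurable_PiM_gauss [simp]:
  "measurable (PiM I (\<lambda>_. gauss 0 s2)) N = measurable (PiM I (\<lambda>_. borel)) N"
  by (rule measurable_cong_sets[OF sets_PiM_cong]) auto

lemma sets_R [measurable_cong, simp]: "sets (R t) = sets (HS t)"
proof -
  have "sets (PiM {Suc 0..t} (\<lambda>_. gauss 0 s2)) = sets (PiM {Suc 0..t} (\<lambda>_. borel :: real measure))"
    by (rule sets_PiM_cong) auto
  then show ?thesis by (intro sets_pair_measure_cong refl)
qed

lemma space_R [simp]: "space (R t) = space (HS t)"
  by (rule sets_eq_imp_space_eq) simp

lemma measurable_E [measurable]: "E t \<in> borel_measurable (HS t)"
proof -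
  have "(\<lambda>h. exp (\<Sum>s=Suc 0..t. (snd h s)\<^sup>2 / (2 * s2))) \<in> borel_measurable (HS t)"
    by measurable
  then show ?thesis unfolding E_def .
qed

section \<open>Integrals over histories and independence of the next noise variable\<close>

lemma nn_integral_Xs_restrict:
  assumes "\<Phi> \<in> borel_measurable (PiM {..t} (\<lambda>_. XM))"
  shows "(\<integral>\<^sup>+x. \<Phi> (restrict x {..t}) \<partial>Xs) = (\<integral>\<^sup>+x. \<Phi> x \<partial>PiM {..t} (\<lambda>_. XM))"
proof -
  have "(\<integral>\<^sup>+x. \<Phi> x \<partial>distr Xs (PiM {..t} (\<lambda>_. XM)) (\<lambda>x. restrict x {..t})) =
      (\<integral>\<^sup>+x. \<Phi> (restrict x {..t}) \<partial>Xs)"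
    using assms by (intro nn_integral_distr) auto
  then show ?thesis by (subst (asm) XP.distr_PiM_restrict_finite) auto
qed

lemma nn_integral_Ws_restrict:
  assumes "\<Phi> \<in> borel_measurable (PiM {Suc 0..t} (\<lambda>_. borel))"
  shows "(\<integral>\<^sup>+w. \<Phi> (restrict w {Suc 0..t}) \<partial>Ws) = (\<integral>\<^sup>+w. \<Phi> w \<partial>PiM {Suc 0..t} (\<lambda>_. gauss 0 s2))"
proof -
  have [measurable]: "\<Phi> \<in> borel_measurable (PiM {Suc 0..t} (\<lambda>_. gauss 0 s2))"
    using assms by simp
  have "(\<integral>\<^sup>+w. \<Phi> w \<partial>distr Ws (PiM {Suc 0..t} (\<lambda>_. gauss 0 s2)) (\<lambda>x. restrict x {Suc 0..t})) =
      (\<integral>\<^sup>+w. \<Phi> (restrict w {Suc 0..t}) \<partial>Ws)"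
    by (intro nn_integral_distr) auto
  then show ?thesis by (subst (asm) WP.distr_PiM_restrict_finite) auto
qed

text \<open>The infinite product is first cut down to the times 1 to t + 1, where splitting off the
  last coordinate is Fubini for a finite product.\<close>

lemma nn_integral_Ws_split:
  assumes F [measurable]: "F \<in> borel_measurable (PiM {Suc 0..t} (\<lambda>_. borel) \<Otimes>\<^sub>M borel)"
  shows "(\<integral>\<^sup>+w. F (restrict w {Suc 0..t}, w (Suc t)) \<partial>Ws) =
    (\<integral>\<^sup>+w. (\<integral>\<^sup>+v. F (restrict w {Suc 0..t}, v) \<partial>gauss 0 s2) \<partial>Ws)"
proof -
  let ?F = "\<lambda>w. F (restrict w {Suc 0..t}, w (Suc t))"
  have I: "{Suc 0..Suc t} = insert (Suc t) {Suc 0..t}" by auto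
  have m: "?F \<in> borel_measurable (PiM {Suc 0..Suc t} (\<lambda>_. borel))" 
  proof -
    have [measurable]: "(\<lambda>w. restrict w {Suc 0..t}) \<in>
        PiM {Suc 0..Suc t} (\<lambda>_. borel) \<rightarrow>\<^sub>M PiM {Suc 0..t} (\<lambda>_. borel :: real measure)"
      by (rule measurable_restrict_subset) auto
    show ?thesis by measurable
  qed
  have "(\<integral>\<^sup>+w. F (restrict w {Suc 0..t}, w (Suc t)) \<partial>Ws) = (\<integral>\<^sup>+w. ?F (restrict w {Suc 0..Suc t}) \<partial>Ws)"
    by (simp add: Int_absorb1)
  also have "\<dots> = (\<integral>\<^sup>+w. ?F w \<partial>PiM {Suc 0..Suc t} (\<lambda>_. gauss 0 s2))"
    by (rule nn_integral_Ws_restrict[OF m])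
  also have "\<dots> = (\<integral>\<^sup>+w. (\<integral>\<^sup>+v. ?F (w(Suc t := v)) \<partial>gauss 0 s2) \<partial>PiM {Suc 0..t} (\<lambda>_. gauss 0 s2))"
    unfolding I
  proof (rule WP.product_nn_integral_insert)
    show "?F \<in> borel_measurable (PiM (insert (Suc t) {Suc 0..t}) (\<lambda>_. gauss 0 s2))"
      using m unfolding I by simp
  qed auto
  also have "\<dots> = (\<integral>\<^sup>+w. (\<integral>\<^sup>+v. F (w, v) \<partial>gauss 0 s2) \<partial>PiM {Suc 0..t} (\<lambda>_. gauss 0 s2))"
  proof (intro nn_integral_cong arg_cong[where f=F])
    fix w v assume "w \<in> space (PiM {Suc 0..t} (\<lambda>_. gauss 0 s2))"
    then show "(restrict (w(Suc t := v)) {Suc 0..t}, (w(Suc t := v)) (Suc t)) = (w, v)"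
      by (auto simp: fun_eq_iff space_PiM PiE_def extensional_def restrict_def)
  qed
  also have "\<dots> = (\<integral>\<^sup>+w. (\<integral>\<^sup>+v. F (restrict w {Suc 0..t}, v) \<partial>gauss 0 s2) \<partial>Ws)"
    by (rule nn_integral_Ws_restrict[symmetric]) measurable
  finally show ?thesis .
qed

lemma nn_integral_Om:
  assumes "g \<in> borel_measurable Om"
  shows "(\<integral>\<^sup>+\<omega>. g \<omega> \<partial>Om) = (\<integral>\<^sup>+\<theta>. \<integral>\<^sup>+x. \<integral>\<^sup>+w. g (\<theta>, x, w) \<partial>Ws \<partial>Xs \<partial>P)"
proof -
  have "(\<integral>\<^sup>+\<omega>. g \<omega> \<partial>Om) = (\<integral>\<^sup>+\<theta>. \<integral>\<^sup>+z. g (\<theta>, z) \<partial>(Xs \<Otimes>\<^sub>M Ws) \<partial>P)"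
    using XW.P.nn_integral_fst[OF assms] by simp
  also have "\<dots> = (\<integral>\<^sup>+\<theta>. \<integral>\<^sup>+x. \<integral>\<^sup>+w. g (\<theta>, x, w) \<partial>Ws \<partial>Xs \<partial>P)"
  proof (rule nn_integral_cong)
    fix \<theta> assume \<theta>: "\<theta> \<in> space P"
    have "(\<lambda>z. g (\<theta>, z)) \<in> borel_measurable (Xs \<Otimes>\<^sub>M Ws)"
      using measurable_compose[OF measurable_Pair1'[OF \<theta>] assms] .
    from WP.P.nn_integral_fst[OF this]
    show "(\<integral>\<^sup>+z. g (\<theta>, z) \<partial>(Xs \<Otimes>\<^sub>M Ws)) = (\<integral>\<^sup>+x. \<integral>\<^sup>+w. g (\<theta>, x, w) \<partial>Ws \<partial>Xs)"
      by simp
  qed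
  finally show ?thesis .
qed

text \<open>Integral form of the independence of W_{t+1} from (\<theta>, H_t): for fixed weights and
  inputs, the history is a function of the first t noise variables.\<close>

lemma nn_integral_H_W:
  assumes g [measurable]: "g \<in> borel_measurable ((P \<Otimes>\<^sub>M HS t) \<Otimes>\<^sub>M borel)"
  shows "(\<integral>\<^sup>+\<omega>. g ((fst \<omega>, H t \<omega>), snd (snd \<omega>) (Suc t)) \<partial>Om) =
    (\<integral>\<^sup>+\<omega>. (\<integral>\<^sup>+v. g ((fst \<omega>, H t \<omega>), v) \<partial>gauss 0 s2) \<partial>Om)"
proof -
  have [measurable]: "(\<lambda>w. \<integral>\<^sup>+v. g (w, v) \<partial>gauss 0 s2) \<in> borel_measurable (P \<Otimes>\<^sub>M HS t)"
    by measurable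
  have 1: "(\<lambda>\<omega>. g ((fst \<omega>, H t \<omega>), snd (snd \<omega>) (Suc t))) \<in> borel_measurable Om"
    by measurable
  have 2: "(\<lambda>\<omega>. \<integral>\<^sup>+v. g ((fst \<omega>, H t \<omega>), v) \<partial>gauss 0 s2) \<in> borel_measurable Om"
    by measurable
  show ?thesis
    unfolding nn_integral_Om[OF 1] nn_integral_Om[OF 2]
  proof (rule nn_integral_cong, rule nn_integral_cong)
    fix \<theta> x assume [measurable]: "\<theta> \<in> space P" "x \<in> space Xs"
    have [measurable]: "x s \<in> space XM" for s using \<open>x \<in> space Xs\<close> by (auto simp: space_PiM)
    let ?F = "\<lambda>(w, v). g ((\<theta>, (restrict x {..t}, \<lambda>s\<in>{Suc 0..t}. f \<theta> (x (s - 1)) + w s)), v)"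
    have "?F \<in> borel_measurable (PiM {Suc 0..t} (\<lambda>_. borel) \<Otimes>\<^sub>M borel)"
      unfolding case_prod_beta by measurable
    from nn_integral_Ws_split[OF this]
    show "(\<integral>\<^sup>+w. g ((fst (\<theta>, x, w), H t (\<theta>, x, w)), snd (snd (\<theta>, x, w)) (Suc t)) \<partial>Ws) =
        (\<integral>\<^sup>+w. \<integral>\<^sup>+v. g ((fst (\<theta>, x, w), H t (\<theta>, x, w)), v) \<partial>gauss 0 s2 \<partial>Ws)"
      by (simp add: H_def Y_def cong: restrict_cong)
  qed
qed

text \<open>Change of measure to pure-noise labels. Tonelli then places \<theta> innermost, so that
  conditioning on the history becomes integration against the unnormalised posterior
  \<open>exp (- G t \<theta> h)\<close>.\<close>

lemma nn_integral_H:
  assumes g [measurable]: "g \<in> borel_measurable (P \<Otimes>\<^sub>M HS t)"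
  shows "(\<integral>\<^sup>+\<omega>. g (fst \<omega>, H t \<omega>) \<partial>Om) =
    (\<integral>\<^sup>+h. (\<integral>\<^sup>+\<theta>. g (\<theta>, h) * ennreal (exp (- G t \<theta> h)) \<partial>P) * ennreal (E t h) \<partial>R t)"
proof -
  interpret R: pair_prob_space "PiM {..t} (\<lambda>_. XM)" "PiM {Suc 0..t} (\<lambda>_. gauss 0 s2)" ..
  interpret PR: pair_prob_space P "R t" ..
  interpret GF: gauss_family "{Suc 0..t}" "\<lambda>_. s2" by unfold_locales (auto simp: s2)
  have [measurable]: "(\<lambda>z. G t (fst z) (snd z)) \<in> borel_measurable (P \<Otimes>\<^sub>M HS t)"
    using measurable_G[of t t t, OF order_refl le_SucI[OF order_refl]] unfolding case_prod_unfold .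
  let ?g = "\<lambda>\<theta> h. g (\<theta>, h) * ennreal (exp (- G t \<theta> h)) * ennreal (E t h)"
  have m [measurable]: "(\<lambda>z. ?g (fst z) (snd z)) \<in> borel_measurable (P \<Otimes>\<^sub>M R t)" by measurable
  have "(\<integral>\<^sup>+\<omega>. g (fst \<omega>, H t \<omega>) \<partial>Om) = 
      (\<integral>\<^sup>+\<theta>. \<integral>\<^sup>+x. \<integral>\<^sup>+w. g (\<theta>, H t (\<theta>, x, w)) \<partial>Ws \<partial>Xs \<partial>P)"
    by (subst nn_integral_Om) auto
  also have "\<dots> = (\<integral>\<^sup>+\<theta>. \<integral>\<^sup>+h. ?g \<theta> h \<partial>R t \<partial>P)"
  proof (rule nn_integral_cong)
    fix \<theta> assume \<theta> [measurable]: "\<theta> \<in> space P"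
    let ?y = "\<lambda>x w. \<lambda>s\<in>{Suc 0..t}. f \<theta> (x (s - 1)) + w s"
    have mg [measurable]: "(\<lambda>h. ?g \<theta> h) \<in> borel_measurable (R t)"
      using measurable_compose[OF measurable_Pair1'[OF \<theta>] m] by simp
    have mg' [measurable]: "(\<lambda>h. g (\<theta>, h)) \<in> borel_measurable (HS t)" by measurable
    have my: "(\<lambda>z. ?y (fst z) (snd z)) \<in> HS t \<rightarrow>\<^sub>M PiM {Suc 0..t} (\<lambda>_. borel)"
    proof (rule measurable_restrict)
      fix s assume "s \<in> {Suc 0..t}"
      then have [measurable]: "(\<lambda>x. x s) \<in> PiM {Suc 0..t} (\<lambda>_. borel) \<rightarrow>\<^sub>M (borel :: real measure)"
        "(\<lambda>x. x (s - 1)) \<in> PiM {..t} (\<lambda>_. XM) \<rightarrow>\<^sub>M XM"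
        by (auto intro!: measurable_component_singleton)
      show "(\<lambda>z. f \<theta> (fst z (s - 1)) + snd z s) \<in> borel_measurable (HS t)" by measurable
    qed
    have *: "(\<integral>\<^sup>+w. g (\<theta>, H t (\<theta>, x, w)) \<partial>Ws) =
        (\<integral>\<^sup>+y. ?g \<theta> (restrict x {..t}, y) \<partial>PiM {Suc 0..t} (\<lambda>_. gauss 0 s2))" if x: "x \<in> space Xs" for x
    proof -
      have rx: "restrict x {..t} \<in> space (PiM {..t} (\<lambda>_. XM))" using x by (auto simp: space_PiM)
      let ?F = "\<lambda>w. g (\<theta>, (restrict x {..t}, ?y (restrict x {..t}) w))"
      have F: "?F \<in> borel_measurable (PiM {Suc 0..t} (\<lambda>_. borel))"
        using measurable_compose[OF measurable_Pair1'[OF rx] my] rx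
        by (auto intro!: measurable_compose[OF _ mg'] measurable_Pair)
      have "(\<integral>\<^sup>+w. g (\<theta>, H t (\<theta>, x, w)) \<partial>Ws) = (\<integral>\<^sup>+w. ?F (restrict w {Suc 0..t}) \<partial>Ws)"
        by (intro nn_integral_cong arg_cong[where f=g]) (auto simp: H_def Y_def intro!: restrict_ext)
      also have "\<dots> = (\<integral>\<^sup>+w. ?F w \<partial>GF.GP)"
        by (rule nn_integral_Ws_restrict[OF F])
      \<comment> \<open>Each noise value is written as label minus network output, a shift with
        Jacobian 1. The quotient of the Gaussian weights is the factor \<open>exp (- G)\<close>
        times \<open>E\<close>, and adding the outputs back restores y.\<close>
      also have "\<dots> = (\<integral>\<^sup>+y. ennreal (\<Prod>s=Suc 0..t. 1 *
          exp (((y s)\<^sup>2 - (- f \<theta> (x (s - 1)) + 1 * y s)\<^sup>2) / (2 * s2))) *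
          ?F (\<lambda>s\<in>{Suc 0..t}. - f \<theta> (x (s - 1)) + 1 * y s) \<partial>GF.GP)"
        using F by (intro GF.nn_integral_GP_affine) simp_all
      also have "\<dots> = (\<integral>\<^sup>+y. ?g \<theta> (restrict x {..t}, y) \<partial>PiM {Suc 0..t} (\<lambda>_. gauss 0 s2))"
      proof (rule nn_integral_cong)
        fix y assume y: "y \<in> space GF.GP"
        have "?y (restrict x {..t}) (\<lambda>s\<in>{Suc 0..t}. - f \<theta> (x (s - 1)) + 1 * y s) = y"
          using y by (auto simp: fun_eq_iff space_PiM PiE_def extensional_def)
        moreover have "(\<Prod>s=Suc 0..t. 1 * exp (((y s)\<^sup>2 - (- f \<theta> (x (s - 1)) + 1 * y s)\<^sup>2) / (2 * s2))) =
            exp (- G t \<theta> (restrict x {..t}, y)) * E t (restrict x {..t}, y)"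
          unfolding G_def E_def
          by (simp add: exp_sum [symmetric] exp_add [symmetric] sum_negf [symmetric] sum.distrib [symmetric])
             (auto intro!: sum.cong simp: diff_divide_distrib power2_commute)
        ultimately show "ennreal (\<Prod>s=Suc 0..t. 1 *
            exp (((y s)\<^sup>2 - (- f \<theta> (x (s - 1)) + 1 * y s)\<^sup>2) / (2 * s2))) *
          ?F (\<lambda>s\<in>{Suc 0..t}. - f \<theta> (x (s - 1)) + 1 * y s) = ?g \<theta> (restrict x {..t}, y)"
          by (simp add: ennreal_mult' mult_ac) (simp add: E_def ennreal_mult mult_ac)
      qed
      finally show ?thesis .
    qed
    have "(\<integral>\<^sup>+x. \<integral>\<^sup>+w. g (\<theta>, H t (\<theta>, x, w)) \<partial>Ws \<partial>Xs) =
        (\<integral>\<^sup>+x. \<integral>\<^sup>+y. ?g \<theta> (restrict x {..t}, y) \<partial>PiM {Suc 0..t} (\<lambda>_. gauss 0 s2) \<partial>Xs)"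
      by (intro nn_integral_cong *)
    also have "\<dots> = (\<integral>\<^sup>+x. \<integral>\<^sup>+y. ?g \<theta> (x, y) \<partial>PiM {Suc 0..t} (\<lambda>_. gauss 0 s2) \<partial>PiM {..t} (\<lambda>_. XM))"
      by (rule nn_integral_Xs_restrict) (rule WP.P.borel_measurable_nn_integral_fst[OF mg])
    also have "\<dots> = (\<integral>\<^sup>+h. ?g \<theta> h \<partial>R t)"
      by (rule WP.P.nn_integral_fst[OF mg])
    finally show "(\<integral>\<^sup>+x. \<integral>\<^sup>+w. g (\<theta>, H t (\<theta>, x, w)) \<partial>Ws \<partial>Xs) = (\<integral>\<^sup>+h. ?g \<theta> h \<partial>R t)" .
  qed
  also have "\<dots> = (\<integral>\<^sup>+h. \<integral>\<^sup>+\<theta>. ?g \<theta> h \<partial>P \<partial>R t)"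
    using PR.Fubini'[of "\<lambda>\<theta> h. ?g \<theta> h"] m by (simp add: case_prod_beta)
  also have "\<dots> = (\<integral>\<^sup>+h. (\<integral>\<^sup>+\<theta>. g (\<theta>, h) * ennreal (exp (- G t \<theta> h)) \<partial>P) * ennreal (E t h) \<partial>R t)"
  proof (rule nn_integral_cong)
    fix h assume h: "h \<in> space (R t)"
    then have [measurable]: "h \<in> space (HS t)" by simp
    then have [measurable]: "(\<lambda>\<theta>. exp (- G t \<theta> h)) \<in> borel_measurable P"
      by (intro measurable_exp_G[of t t t h]) auto
    have "(\<lambda>\<theta>. g (\<theta>, h) * ennreal (exp (- G t \<theta> h))) \<in> borel_measurable P"
      by measurable
    then show "(\<integral>\<^sup>+\<theta>. ?g \<theta> h \<partial>P) = (\<integral>\<^sup>+\<theta>. g (\<theta>, h) * ennreal (exp (- G t \<theta> h)) \<partial>P) * ennreal (E t h)"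
      by (rule nn_integral_multc)
  qed
  finally show ?thesis .
qed

section \<open>The two predictive laws\<close>

lemma emeasure_gauss_shift:
  assumes [measurable]: "B \<in> sets borel"
  shows "emeasure (gauss m s2) B = (\<integral>\<^sup>+v. indicator B (m + v) \<partial>gauss 0 s2)"
  using nn_integral_gauss_shift[of "indicator B" m s2] by simp

lemma measurable_emeasure_gauss [measurable]:
  assumes [measurable]: "B \<in> sets borel" "g \<in> borel_measurable M"
  shows "(\<lambda>w. emeasure (gauss (g w) s2) B) \<in> borel_measurable M"
proof -
  have "(\<lambda>w. \<integral>\<^sup>+v. indicator B (g w + v) \<partial>gauss 0 s2) \<in> borel_measurable M"
    by measurable
  then show ?thesis by (simp add: emeasure_gauss_shift)
qed

lemma measurable_kernelI:
  fixes K :: "'a \<Rightarrow> real measure"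
  assumes "\<And>z. z \<in> space M \<Longrightarrow> prob_space (K z)" "\<And>z. sets (K z) = sets borel"
    and "\<And>B. B \<in> sets borel \<Longrightarrow> (\<lambda>z. emeasure (K z) B) \<in> borel_measurable M"
  shows "K \<in> M \<rightarrow>\<^sub>M prob_algebra borel"
  by (intro measurable_prob_algebraI measurable_subprob_algebra)
    (simp_all add: assms prob_space_imp_subprob_space)

definition K1 :: "nat \<Rightarrow> 'p \<times> (nat \<Rightarrow> 'x) \<times> (nat \<Rightarrow> real) \<Rightarrow> real measure" where
  "K1 t z = gauss (f (fst z) (fst (snd z) t)) s2"

lemma measurable_f_last [measurable]: "(\<lambda>z. f (fst z) (fst (snd z) t)) \<in> borel_measurable (P \<Otimes>\<^sub>M HS t)"
  by measurable

lemma fst_H [simp]: "fst (H t \<omega>) t = fst (snd \<omega>) t"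
  by (simp add: H_def)

text \<open>Shared by both predictive laws: \<open>K1\<close> uses it directly, \<open>K2\<close>
  with A a cylinder over the history. The label is the output plus noise independent of (\<theta>,
  H_t), and integrating out that noise gives a Gaussian mass.\<close>

lemma emeasure_H_Y:
  assumes A [measurable]: "A \<in> sets (P \<Otimes>\<^sub>M HS t)" and B [measurable]: "B \<in> sets borel"
  shows "emeasure Om {\<omega> \<in> space Om. (fst \<omega>, H t \<omega>) \<in> A \<and> Y (Suc t) \<omega> \<in> B} =
    (\<integral>\<^sup>+\<omega>. indicator A (fst \<omega>, H t \<omega>) * emeasure (K1 t (fst \<omega>, H t \<omega>)) B \<partial>Om)"
proof -
  let ?g = "\<lambda>(z, v). indicator A z * (indicator B (f (fst z) (fst (snd z) t) + v) :: ennreal)"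
  have "?g \<in> borel_measurable ((P \<Otimes>\<^sub>M HS t) \<Otimes>\<^sub>M borel)"
    unfolding case_prod_beta by measurable
  note * = nn_integral_H_W[OF this, simplified]
  have "emeasure Om {\<omega> \<in> space Om. (fst \<omega>, H t \<omega>) \<in> A \<and> Y (Suc t) \<omega> \<in> B} =
      (\<integral>\<^sup>+\<omega>. indicator {\<omega> \<in> space Om. (fst \<omega>, H t \<omega>) \<in> A \<and> Y (Suc t) \<omega> \<in> B} \<omega> \<partial>Om)"
    by (rule nn_integral_indicator[symmetric]) measurable
  also have "\<dots> = (\<integral>\<^sup>+\<omega>. indicator A (fst \<omega>, H t \<omega>) *
      indicator B (f (fst \<omega>) (fst (snd \<omega>) t) + snd (snd \<omega>) (Suc t)) \<partial>Om)"
    by (intro nn_integral_cong) (auto simp: indicator_def Y_def)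
  also have "\<dots> = (\<integral>\<^sup>+\<omega>. (\<integral>\<^sup>+v. indicator A (fst \<omega>, H t \<omega>) *
      indicator B (f (fst \<omega>) (fst (snd \<omega>) t) + v) \<partial>gauss 0 s2) \<partial>Om)"
    by (rule *)
  also have "\<dots> = (\<integral>\<^sup>+\<omega>. indicator A (fst \<omega>, H t \<omega>) * emeasure (K1 t (fst \<omega>, H t \<omega>)) B \<partial>Om)"
    by (intro nn_integral_cong) (simp add: K1_def emeasure_gauss_shift nn_integral_cmult)
  finally show ?thesis .
qed

lemma is_cond_distr_K1: "is_cond_distr Om (P \<Otimes>\<^sub>M HS t) (\<lambda>\<omega>. (fst \<omega>, H t \<omega>)) (Y (Suc t)) (K1 t)"
  unfolding is_cond_distr_def
proof (intro conjI ballI)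
  show K: "K1 t \<in> (P \<Otimes>\<^sub>M HS t) \<rightarrow>\<^sub>M prob_algebra borel"
    by (rule measurable_kernelI) (auto simp: K1_def intro!: prob_space_gauss s2 measurable_emeasure_gauss measurable_f_last)
  fix A B assume A [measurable]: "A \<in> sets (P \<Otimes>\<^sub>M HS t)" and B [measurable]: "B \<in>
      sets (borel :: real measure)"
  have [measurable]: "(\<lambda>z. emeasure (K1 t z) B) \<in> borel_measurable (P \<Otimes>\<^sub>M HS t)"
    unfolding K1_def by measurable
  show "emeasure Om {\<omega> \<in> space Om. (fst \<omega>, H t \<omega>) \<in> A \<and> Y (Suc t) \<omega> \<in> B} =
      (\<integral>\<^sup>+z\<in>A. emeasure (K1 t z) B \<partial>distr Om (P \<Otimes>\<^sub>M HS t) (\<lambda>\<omega>. (fst \<omega>, H t \<omega>)))"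
    unfolding emeasure_H_Y[OF A B]
    by (subst nn_integral_distr) (auto intro!: nn_integral_cong simp: mult.commute)
qed

definition app :: "nat \<Rightarrow> (nat \<Rightarrow> 'x) \<times> (nat \<Rightarrow> real) \<Rightarrow> real \<Rightarrow> (nat \<Rightarrow> 'x) \<times> (nat \<Rightarrow> real)" where
  "app t h v = (fst h, (snd h)(Suc t := v))"

lemma measurable_app [measurable]: "(\<lambda>(h, v). app t h v) \<in> HS t \<Otimes>\<^sub>M borel \<rightarrow>\<^sub>M XY t (Suc t)"
proof -
  have "{Suc 0..Suc t} = insert (Suc t) {Suc 0..t}" by auto
  then have "(\<lambda>z. (snd (fst z))(Suc t := snd z)) \<in>
      HS t \<Otimes>\<^sub>M borel \<rightarrow>\<^sub>M PiM {Suc 0..Suc t} (\<lambda>_. borel :: real measure)"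
    by (simp only:) (rule measurable_fun_upd[where J="{Suc 0..t}"], auto)
  then show ?thesis unfolding app_def case_prod_unfold by measurable
qed

lemma measurable_Z_app [measurable]:
  "(\<lambda>z. Z (Suc t) (app t (fst z) (snd z))) \<in> borel_measurable (HS t \<Otimes>\<^sub>M borel)"
  using measurable_compose[OF measurable_app measurable_Z[of "Suc t" "Suc t" t]] by (simp add: case_prod_unfold)

lemma app_space: "h \<in> space (HS t) \<Longrightarrow> app t h v \<in> space (XY t (Suc t))"
  using measurable_space[OF measurable_app, of "(h, v)" t] by (simp add: space_pair_measure)

lemma G_app: "G (Suc t) \<theta> (app t h v) = G t \<theta> h + (v - f \<theta> (fst h t))\<^sup>2 / (2 * s2)"
  using G_cong[of t "app t h v" h] by (simp add: G_Suc app_def)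

definition c :: real where "c = 1 / sqrt (2 * pi * s2)"

lemma c_pos: "c > 0" using s2 by (simp add: c_def)

lemma normal_density_c: "normal_density m (sqrt s2) v = c * exp (- ((v - m)\<^sup>2 / (2 * s2)))"
  using s2 by (simp add: normal_density_def c_def)

definition K2 :: "nat \<Rightarrow> (nat \<Rightarrow> 'x) \<times> (nat \<Rightarrow> real) \<Rightarrow> real measure" where
  "K2 t h = density lborel (\<lambda>v. ennreal (c * Z (Suc t) (app t h v) / Z t h))"

lemma measurable_Z_app' [measurable]:
  assumes "h \<in> space (HS t)" shows "(\<lambda>v. Z (Suc t) (app t h v)) \<in> borel_measurable borel"
  using measurable_compose[OF measurable_Pair1'[OF assms] measurable_Z_app] by simp

text \<open>Bayes' rule: \<open>K2\<close> is the posterior mixture of the Gaussians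
  \<open>K1\<close>. The likelihood at t + 1 factors into the one at t and a Gaussian factor in v,
  and Tonelli exchanges v with \<theta>. Multiplying by \<open>Z t h\<close> avoids a division in
  \<open>ennreal\<close>.\<close>

lemma emeasure_K2:
  assumes h [measurable]: "h \<in> space (HS t)" and B [measurable]: "B \<in> sets borel"
  shows "emeasure (K2 t h) B * ennreal (Z t h) =
    (\<integral>\<^sup>+\<theta>. emeasure (K1 t (\<theta>, h)) B * ennreal (exp (- G t \<theta> h)) \<partial>P)"
proof -
  interpret pair_sigma_finite P lborel ..
  have Z: "Z t h > 0" by (rule Z_pos[OF _ _ h]) auto
  have [measurable]: "(\<lambda>\<theta>. exp (- G t \<theta> h)) \<in>
      borel_measurable P" by (rule measurable_exp_G[OF _ _ h]) auto
  have hx: "fst h t \<in> space XM" using h by (auto simp: space_pair_measure space_PiM)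
  have [measurable]: "(\<lambda>\<theta>. f \<theta> (fst h t)) \<in> borel_measurable P" using hx by measurable
  let ?g = "\<lambda>\<theta> v. ennreal (exp (- G t \<theta> h)) *
      (ennreal (normal_density (f \<theta> (fst h t)) (sqrt s2) v) * indicator B v)"
  have m [measurable]: "(\<lambda>z. ?g (fst z) (snd z)) \<in> borel_measurable (P \<Otimes>\<^sub>M lborel)"
    unfolding normal_density_c by measurable
  have "emeasure (K2 t h) B * ennreal (Z t h) =
      (\<integral>\<^sup>+v. ennreal (c * Z (Suc t) (app t h v) / Z t h) * indicator B v * ennreal (Z t h) \<partial>lborel)"
    unfolding K2_def by (subst emeasure_density) (auto intro!: nn_integral_multc[symmetric])
  also have "\<dots> = (\<integral>\<^sup>+v. \<integral>\<^sup>+\<theta>. ?g \<theta> v \<partial>P \<partial>lborel)"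
  proof (rule nn_integral_cong)
    fix v
    have mv: "(\<lambda>\<theta>. ennreal (exp (- G (Suc t) \<theta> (app t h v)))) \<in> borel_measurable P"
      using measurable_exp_G[OF _ _ app_space[OF h], of "Suc t" v] by simp
    have "ennreal (c * Z (Suc t) (app t h v) / Z t h) * indicator B v * ennreal (Z t h) =
        ennreal (c * Z (Suc t) (app t h v)) * indicator B v"
      using Z c_pos Z_pos[OF _ _ app_space[OF h], of "Suc t" v]
      by (cases "v \<in> B") (auto simp: ennreal_mult'[symmetric])
    also have "\<dots> = (\<integral>\<^sup>+\<theta>. ennreal (exp (- G (Suc t) \<theta> (app t h v))) \<partial>P) * (ennreal c * indicator B v)"
      using nn_integral_exp_G[OF _ _ app_space[OF h], of "Suc t" v] c_pos
      by (simp add: ennreal_mult' mult_ac)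
    also have "\<dots> = (\<integral>\<^sup>+\<theta>. ennreal (exp (- G (Suc t) \<theta> (app t h v))) * (ennreal c * indicator B v) \<partial>P)"
      by (rule nn_integral_multc[symmetric, OF mv])
    also have "\<dots> = (\<integral>\<^sup>+\<theta>. ?g \<theta> v \<partial>P)"
    proof (rule nn_integral_cong)
      fix \<theta>
      have "exp (- G (Suc t) \<theta> (app t h v)) =
          exp (- G t \<theta> h) * exp (- ((v - f \<theta> (fst h t))\<^sup>2 / (2 * s2)))"
        by (simp add: G_app exp_add[symmetric])
      then show "ennreal (exp (- G (Suc t) \<theta> (app t h v))) * (ennreal c * indicator B v) = ?g \<theta> v"
        using c_pos by (simp add: normal_density_c ennreal_mult' mult_ac)
    qed
    finally show "ennreal (c * Z (Suc t) (app t h v) / Z t h) * indicator B v * ennreal (Z t h) =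
        (\<integral>\<^sup>+\<theta>. ?g \<theta> v \<partial>P)" .
  qed
  also have "\<dots> = (\<integral>\<^sup>+\<theta>. \<integral>\<^sup>+v. ?g \<theta> v \<partial>lborel \<partial>P)"
    using Fubini'[of ?g] m by (simp add: case_prod_unfold)
  also have "\<dots> = (\<integral>\<^sup>+\<theta>. emeasure (K1 t (\<theta>, h)) B * ennreal (exp (- G t \<theta> h)) \<partial>P)"
    unfolding K1_def gauss_def
    by (intro nn_integral_cong) (simp add: emeasure_density nn_integral_cmult mult.commute)
  finally show ?thesis .
qed

lemma prob_space_K2:
  assumes h: "h \<in> space (HS t)" shows "prob_space (K2 t h)"
proof
  have Z: "Z t h > 0" by (rule Z_pos[OF _ _ h]) auto
  have "emeasure (K2 t h) UNIV * ennreal (Z t h) = ennreal (Z t h)"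
    using nn_integral_exp_G[OF _ _ h, of t]
    by (simp add: emeasure_K2[OF h] K1_def prob_space.emeasure_space_1[OF prob_space_gauss[OF s2], simplified])
  then have "emeasure (K2 t h) UNIV * ennreal (Z t h) / ennreal (Z t h) =
      ennreal (Z t h) / ennreal (Z t h)" by simp
  then show "emeasure (K2 t h) (space (K2 t h)) = 1"
    using Z by (simp add: K2_def ennreal_mult_divide_eq ennreal_divide_self)
qed

lemma measurable_K2 [measurable]:
  assumes [measurable]: "B \<in> sets borel" shows "(\<lambda>h. emeasure (K2 t h) B) \<in> borel_measurable (HS t)"
proof -
  have [measurable]: "Z t \<in> borel_measurable (HS t)" by (rule measurable_Z) auto
  have "(\<lambda>h. \<integral>\<^sup>+v. ennreal (c * Z (Suc t) (app t h v) / Z t h) * indicator B v \<partial>lborel) \<in>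
      borel_measurable (HS t)"
  proof (rule lborel.borel_measurable_nn_integral)
    show "(\<lambda>(h, v). ennreal (c * Z (Suc t) (app t h v) / Z t h) * indicator B v) \<in>
        borel_measurable (HS t \<Otimes>\<^sub>M lborel)"
      unfolding case_prod_unfold by measurable
  qed
  then show ?thesis
    by (rule measurable_cong[THEN iffD1, rotated]) (simp add: K2_def emeasure_density)
qed

text \<open>For a fixed history, the mass of \<open>K1\<close> integrated against the unnormalised
  posterior equals \<open>Z t h\<close> times the mass of \<open>K2\<close>. So \<open>K1\<close>
  may be replaced by \<open>K2\<close> under the reference law, after which the change of measure is
  undone.\<close>

lemma is_cond_distr_K2: "is_cond_distr Om (HS t) (H t) (Y (Suc t)) (K2 t)"
  unfolding is_cond_distr_def
proof (intro conjI ballI)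
  show "K2 t \<in> HS t \<rightarrow>\<^sub>M prob_algebra borel"
    by (rule measurable_kernelI) (auto simp: prob_space_K2 measurable_K2 K2_def[THEN arg_cong[where f=sets]])
  fix A B assume A [measurable]: "A \<in> sets (HS t)" and B [measurable]: "B \<in>
      sets (borel :: real measure)"
  let ?A = "space P \<times> A"
  have A': "?A \<in> sets (P \<Otimes>\<^sub>M HS t)" by measurable
  have [measurable]: "(\<lambda>z. emeasure (K1 t z) B) \<in> borel_measurable (P \<Otimes>\<^sub>M HS t)"
    unfolding K1_def by measurable
  have m: "(\<lambda>\<theta>. ennreal (exp (- G t \<theta> h))) \<in> borel_measurable P" if "h \<in> space (HS t)" for h
    using measurable_exp_G[OF _ _ that, of t] by simp
  have "emeasure Om {\<omega> \<in> space Om. H t \<omega> \<in> A \<and> Y (Suc t) \<omega> \<in> B} =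
      emeasure Om {\<omega> \<in> space Om. (fst \<omega>, H t \<omega>) \<in> ?A \<and> Y (Suc t) \<omega> \<in> B}"
    by (rule arg_cong[where f="emeasure Om"]) (auto simp: space_pair_measure)
  also have "\<dots> = (\<integral>\<^sup>+\<omega>. indicator A (H t \<omega>) * emeasure (K1 t (fst \<omega>, H t \<omega>)) B \<partial>Om)"
    unfolding emeasure_H_Y[OF A' B]
    by (intro nn_integral_cong) (auto simp: indicator_def space_pair_measure)
  also have "\<dots> = (\<integral>\<^sup>+h. (\<integral>\<^sup>+\<theta>. indicator A h * emeasure (K1 t (\<theta>, h)) B *
      ennreal (exp (- G t \<theta> h)) \<partial>P) * ennreal (E t h) \<partial>R t)"
    using nn_integral_H[of "\<lambda>z. indicator A (snd z) * emeasure (K1 t z) B" t] by simp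
  also have "\<dots> = (\<integral>\<^sup>+h. (\<integral>\<^sup>+\<theta>. emeasure (K2 t h) B * indicator A h * 
      ennreal (exp (- G t \<theta> h)) \<partial>P) * ennreal (E t h) \<partial>R t)"
  proof (rule nn_integral_cong, rule arg_cong2[where f="(*)", OF _ refl])
    fix h assume "h \<in> space (R t)"
    then have h: "h \<in> space (HS t)" by simp
    have [measurable]: "(\<lambda>\<theta>. emeasure (K1 t (\<theta>, h)) B) \<in> borel_measurable P"
      using h by measurable
    note [measurable] = m[OF h]
    have "(\<integral>\<^sup>+\<theta>. indicator A h * emeasure (K1 t (\<theta>, h)) B * ennreal (exp (- G t \<theta> h)) \<partial>P) =
        indicator A h * (\<integral>\<^sup>+\<theta>. emeasure (K1 t (\<theta>, h)) B * ennreal (exp (- G t \<theta> h)) \<partial>P)"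
      by (subst nn_integral_cmult[symmetric]) (auto simp: mult.assoc)
    also have "\<dots> = emeasure (K2 t h) B * indicator A h * (\<integral>\<^sup>+\<theta>. ennreal (exp (- G t \<theta> h)) \<partial>P)"
      unfolding nn_integral_exp_G[OF order_refl le_SucI[OF order_refl] h]
      emeasure_K2[OF h B, symmetric] by (simp only: mult_ac)
    also have "\<dots> = (\<integral>\<^sup>+\<theta>. emeasure (K2 t h) B * indicator A h * ennreal (exp (- G t \<theta> h)) \<partial>P)"
      by (rule nn_integral_cmult[symmetric]) measurable
    finally show "(\<integral>\<^sup>+\<theta>. indicator A h * emeasure (K1 t (\<theta>, h)) B * ennreal (exp (- G t \<theta> h)) \<partial>P) =
      (\<integral>\<^sup>+\<theta>. emeasure (K2 t h) B * indicator A h * ennreal (exp (- G t \<theta> h)) \<partial>P)" .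
  qed
  also have "\<dots> = (\<integral>\<^sup>+\<omega>. emeasure (K2 t (H t \<omega>)) B * indicator A (H t \<omega>) \<partial>Om)"
    using nn_integral_H[of "\<lambda>z. emeasure (K2 t (snd z)) B * indicator A (snd z)" t] by simp
  also have "\<dots> = (\<integral>\<^sup>+h\<in>A. emeasure (K2 t h) B \<partial>distr Om (HS t) (H t))"
    by (subst nn_integral_distr) auto
  finally show "emeasure Om {\<omega> \<in> space Om. H t \<omega> \<in> A \<and> Y (Suc t) \<omega> \<in> B} =
      (\<integral>\<^sup>+h\<in>A. emeasure (K2 t h) B \<partial>distr Om (HS t) (H t))" .
qed

section \<open>Divergences and their telescoping sum\<close>

text \<open>The log-likelihood ratio of the two predictive densities at the label with noise \<open>v\<close>; its
  mean over the noise is the divergence at \<open>z\<close>.\<close>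
definition D :: "nat \<Rightarrow> 'p \<times> (nat \<Rightarrow> 'x) \<times> (nat \<Rightarrow> real) \<Rightarrow> real \<Rightarrow> real" where
  "D t z v = - v\<^sup>2 / (2 * s2) - ln (Z (Suc t) (app t (snd z) (f (fst z) (fst (snd z) t) + v))) +
      ln (Z t (snd z))"

lemma measurable_D [measurable]: "(\<lambda>x. D t (fst x) (snd x)) \<in> borel_measurable ((P \<Otimes>\<^sub>M HS t) \<Otimes>\<^sub>M borel)"
proof -
  have [measurable]: "Z t \<in> borel_measurable (HS t)" by (rule measurable_Z) auto
  have "(\<lambda>x. (snd (fst x), f (fst (fst x)) (fst (snd (fst x)) t) + snd x)) \<in>
      (P \<Otimes>\<^sub>M HS t) \<Otimes>\<^sub>M borel \<rightarrow>\<^sub>M HS t \<Otimes>\<^sub>M borel" by measurable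
  from measurable_compose[OF this measurable_Z_app]
  have [measurable]: "(\<lambda>x. Z (Suc t) (app t (snd (fst x)) (f (fst (fst x)) (fst (snd (fst x)) t) +
      snd x))) \<in>
      borel_measurable ((P \<Otimes>\<^sub>M HS t) \<Otimes>\<^sub>M borel)" by simp
  show ?thesis unfolding D_def by measurable
qed

text \<open>Nonnegativity matters because expectations are taken of the divergence passed through
  \<open>ennreal\<close>, which would cut negative values to 0.\<close>

lemma
  assumes \<theta>: "\<theta> \<in> space P" and h: "h \<in> space (HS t)"
  shows dKL_eq: "dKL (K1 t (\<theta>, h)) (K2 t h) = (\<integral>v. D t (\<theta>, h) v \<partial>gauss 0 s2)"
    and dKL_nonneg: "dKL (K1 t (\<theta>, h)) (K2 t h) \<ge> 0"
proof -
  define m where "m = f \<theta> (fst h t)"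
  let ?p = "normal_density m (sqrt s2)"
  let ?q = "\<lambda>v. c * Z (Suc t) (app t h v) / Z t h"
  let ?L = "\<lambda>v. - (v - m)\<^sup>2 / (2 * s2) - ln (Z (Suc t) (app t h v)) + ln (Z t h)"
  note [measurable] = measurable_Z_app'[OF h]
  have Z: "Z t h > 0" by (rule Z_pos[OF _ _ h]) auto
  have Z': "Z (Suc t) (app t h v) > 0" for v by (rule Z_pos[OF _ _ app_space[OF h]]) auto
  have nz: "Z (Suc t) (app t h v) \<noteq> 0" for v using Z'[of v] by simp
  have q: "?q v > 0" for v using Z Z' c_pos by simp
  have K: "K1 t (\<theta>, h) = density lborel ?p" "K2 t h = density lborel ?q"
    by (simp_all add: K1_def gauss_def m_def K2_def)
  have L: "log (exp 1) (?p v / ?q v) = ?L v" for v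
  proof -
    have "?p v / ?q v = exp (- ((v - m)\<^sup>2 / (2 * s2))) * Z t h / Z (Suc t) (app t h v)"
      using c_pos by (simp add: normal_density_c)
    then show ?thesis
      using Z Z'[of v] by (simp add: log_def ln_mult ln_div)
  qed
  have 1: "dKL (K1 t (\<theta>, h)) (K2 t h) = (\<integral>v. ?p v * ?L v \<partial>lborel)"
    unfolding dKL_def K L[symmetric]
    by (rule lborel.KL_density_density) (use q nz Z c_pos in \<open>simp_all add: less_imp_le\<close>)
  have "(\<integral>v. ?p v * ?L v \<partial>lborel) = (\<integral>v. ?p (m + v) * ?L (m + v) \<partial>lborel)"
    using lborel_integral_real_affine[of 1 "\<lambda>v. ?p v * ?L v" m] by simp
  also have "\<dots> = (\<integral>v. D t (\<theta>, h) v \<partial>gauss 0 s2)"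
  proof -
    have "(\<theta>, h) \<in> space (P \<Otimes>\<^sub>M HS t)" using \<theta> h by (simp add: space_pair_measure)
    from measurable_compose[OF measurable_Pair1'[OF this] measurable_D]
    have "D t (\<theta>, h) \<in> borel_measurable borel" by simp
    then show ?thesis unfolding gauss_def
      by (subst integral_density) (auto simp: D_def m_def normal_density_def)
  qed
  finally show "dKL (K1 t (\<theta>, h)) (K2 t h) = (\<integral>v. D t (\<theta>, h) v \<partial>gauss 0 s2)"
    using 1 by simp
  show "dKL (K1 t (\<theta>, h)) (K2 t h) \<ge> 0"
  \<comment> \<open>Gibbs' inequality needs an integrable log-ratio. Otherwise the Bochner integral
    is 0 by convention, which is still nonnegative.\<close>
  proof (cases "integrable lborel (\<lambda>v. ?p v * ?L v)")
    case True
    show ?thesis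
      unfolding dKL_def K
    proof (rule lborel.KL_density_density_nonneg)
      show "prob_space (density lborel ?p)" using s2 by (intro prob_space_normal_density) simp
      show "prob_space (density lborel ?q)" using prob_space_K2[OF h] by (simp add: K)
      show "integrable lborel (\<lambda>v. ?p v * log (exp 1) (?p v / ?q v))" using True by (simp only: L)
    qed (use q nz Z c_pos in \<open>simp_all add: less_imp_le\<close>)
  qed (simp add: 1 not_integrable_integral_eq)
qed

text \<open>\<open>D\<close> takes both signs, so independence of the next noise is put as an
  identity of measures, to which Fubini for Bochner integrals applies.\<close>

lemma distr_H_W:
  "distr Om ((P \<Otimes>\<^sub>M HS t) \<Otimes>\<^sub>M borel) (\<lambda>\<omega>. ((fst \<omega>, H t \<omega>), snd (snd \<omega>) (Suc t))) =
    distr Om (P \<Otimes>\<^sub>M HS t) (\<lambda>\<omega>. (fst \<omega>, H t \<omega>)) \<Otimes>\<^sub>M gauss 0 s2"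
  (is "?l = ?J \<Otimes>\<^sub>M _")
proof -
  interpret J: prob_space ?J by (rule Om.P.prob_space_distr) measurable
  interpret pair_sigma_finite ?J "gauss 0 s2" ..
  show ?thesis
  proof (rule pair_measure_eqI[symmetric])
    show "sets (?J \<Otimes>\<^sub>M gauss 0 s2) = sets ?l" by (simp cong: sets_pair_measure_cong)
    fix A B assume "A \<in> sets ?J" "B \<in> sets (gauss 0 s2)"
    then have [measurable]: "A \<in> sets (P \<Otimes>\<^sub>M HS t)" "B \<in> sets borel" by simp_all
    have "emeasure ?l (A \<times> B) = (\<integral>\<^sup>+x. indicator (A \<times> B) x \<partial>?l)" by simp
    also have "\<dots> = (\<integral>\<^sup>+\<omega>. indicator (A \<times> B) ((fst \<omega>, H t \<omega>), snd (snd \<omega>) (Suc t)) \<partial>Om)"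
      by (rule nn_integral_distr) measurable
    also have "\<dots> = (\<integral>\<^sup>+\<omega>. \<integral>\<^sup>+v. indicator (A \<times> B) ((fst \<omega>, H t \<omega>), v) \<partial>gauss 0 s2 \<partial>Om)"
      by (rule nn_integral_H_W) measurable
    also have "\<dots> = (\<integral>\<^sup>+\<omega>. indicator A (fst \<omega>, H t \<omega>) * emeasure (gauss 0 s2) B \<partial>Om)"
      by (intro nn_integral_cong) (simp add: indicator_times nn_integral_cmult)
    also have "\<dots> = (\<integral>\<^sup>+\<omega>. indicator A (fst \<omega>, H t \<omega>) \<partial>Om) * emeasure (gauss 0 s2) B"
      by (rule nn_integral_multc) measurable
    also have "(\<integral>\<^sup>+\<omega>. indicator A (fst \<omega>, H t \<omega>) \<partial>Om) = (\<integral>\<^sup>+z. indicator A z \<partial>?J)"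
      by (rule nn_integral_distr[symmetric]) measurable
    finally show "emeasure ?J A * emeasure (gauss 0 s2) B = emeasure ?l (A \<times> B)" by simp
  qed unfold_locales
qed

lemma nn_integral_Om_W:
  assumes [measurable]: "g \<in> borel_measurable borel"
  shows "(\<integral>\<^sup>+\<omega>. g (snd (snd \<omega>) (Suc t)) \<partial>Om) = (\<integral>\<^sup>+v. g v \<partial>gauss 0 s2)"
  using nn_integral_H_W[of "\<lambda>z. g (snd z)" t] by (simp add: Om.P.emeasure_space_1)

lemma
  shows integrable_W_square: "integrable Om (\<lambda>\<omega>. (snd (snd \<omega>) (Suc t))\<^sup>2)"
    and integral_W_square: "(\<integral>\<omega>. (snd (snd \<omega>) (Suc t))\<^sup>2 \<partial>Om) = s2"
proof -
  have *: "(\<integral>\<^sup>+\<omega>. ennreal ((snd (snd \<omega>) (Suc t))\<^sup>2) \<partial>Om) = ennreal s2"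
    using nn_integral_Om_W[of "\<lambda>v. ennreal (v\<^sup>2)" t] nn_integral_gauss_square[OF s2, of 0 1] by simp
  show "integrable Om (\<lambda>\<omega>. (snd (snd \<omega>) (Suc t))\<^sup>2)"
    by (rule integrableI_nonneg) (auto simp: *)
  show "(\<integral>\<omega>. (snd (snd \<omega>) (Suc t))\<^sup>2 \<partial>Om) = s2"
    using * s2 by (subst integral_eq_nn_integral) auto
qed

lemma Z_app_H: "Z (Suc t) (app t (H t \<omega>) (Y (Suc t) \<omega>)) = Z (Suc t) (H (Suc t) \<omega>)"
  by (rule Z_cong) (auto simp: app_def H_def le_Suc_eq)

lemma D_H: "D t (fst \<omega>, H t \<omega>) (snd (snd \<omega>) (Suc t)) =
    - (snd (snd \<omega>) (Suc t))\<^sup>2 / (2 * s2) - ln (Z (Suc t) (H (Suc t) \<omega>)) + ln (Z t (H t \<omega>))"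
  unfolding Z_app_H[symmetric] by (simp add: D_def Y_def)

text \<open>At the actual noise value, \<open>D\<close> is a difference of consecutive
  \<open>ln Z\<close> terms minus \<open>W^2 / (2 s2)\<close>, and the latter has mean 1/2. Fubini
  identifies its expectation with that of the divergence, from which r also inherits its
  sign.\<close>

lemma expected_dKL:
  assumes int: "integrable Om (\<lambda>\<omega>. ln (Z t (H t \<omega>)))" "integrable Om (\<lambda>\<omega>. ln (Z (Suc t) (H (Suc t) \<omega>)))"
  defines "r \<equiv> (\<integral>\<omega>. ln (Z t (H t \<omega>)) \<partial>Om) - (\<integral>\<omega>. ln (Z (Suc t) (H (Suc t) \<omega>)) \<partial>Om) - 1 / 2"
  shows "(\<integral>\<^sup>+\<omega>. ennreal (dKL (K1 t (fst \<omega>, H t \<omega>)) (K2 t (H t \<omega>))) \<partial>Om) = ennreal r" and "r \<ge> 0"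
proof -
  let ?J = "distr Om (P \<Otimes>\<^sub>M HS t) (\<lambda>\<omega>. (fst \<omega>, H t \<omega>))"
  let ?DH = "\<lambda>\<omega>. D t (fst \<omega>, H t \<omega>) (snd (snd \<omega>) (Suc t))"
  let ?I = "\<lambda>z. \<integral>v. D t z v \<partial>gauss 0 s2"
  interpret J: prob_space ?J by (rule Om.P.prob_space_distr) measurable
  interpret pair_sigma_finite ?J "gauss 0 s2" ..
  have i: "integrable Om ?DH"
    unfolding D_H using int integrable_W_square[of t] by auto
  have "(\<integral>\<omega>. ?DH \<omega> \<partial>Om) =
      - s2 / (2 * s2) - (\<integral>\<omega>. ln (Z (Suc t) (H (Suc t) \<omega>)) \<partial>Om) + (\<integral>\<omega>. ln (Z t (H t \<omega>)) \<partial>Om)"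
    unfolding D_H using int integrable_W_square[of t] by (simp add: integral_W_square)
  then have r: "(\<integral>\<omega>. ?DH \<omega> \<partial>Om) = r" using s2 by (simp add: r_def)
  have iJ: "integrable (?J \<Otimes>\<^sub>M gauss 0 s2) (\<lambda>x. D t (fst x) (snd x))"
    unfolding distr_H_W[symmetric] by (subst integrable_distr_eq) (use i in simp_all)
  have rJ: "(\<integral>x. D t (fst x) (snd x) \<partial>(?J \<Otimes>\<^sub>M gauss 0 s2)) = r"
    unfolding distr_H_W[symmetric] by (subst integral_distr) (use r in simp_all)
  have I: "?I z = dKL (K1 t z) (K2 t (snd z))" "?I z \<ge> 0" if "z \<in> space ?J" for z
    using that dKL_eq[of "fst z" "snd z" t] dKL_nonneg[of "fst z" "snd z" t]
    by (auto simp: space_pair_measure)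
  have iI: "integrable ?J ?I" using integrable_fst'[OF iJ] by simp
  have rI: "(\<integral>z. ?I z \<partial>?J) = r" using integral_fst'[OF iJ] rJ by simp
  have mI [measurable]: "?I \<in> borel_measurable (P \<Otimes>\<^sub>M HS t)"
    using borel_measurable_integrable[OF iI] by simp
  have "(\<integral>\<^sup>+\<omega>. ennreal (dKL (K1 t (fst \<omega>, H t \<omega>)) (K2 t (H t \<omega>))) \<partial>Om) =
      (\<integral>\<^sup>+\<omega>. ennreal (?I (fst \<omega>, H t \<omega>)) \<partial>Om)"
  proof (rule nn_integral_cong)
    fix \<omega> assume "\<omega> \<in> space Om"
    then have "(fst \<omega>, H t \<omega>) \<in> space ?J"
      using measurable_space[OF measurable_H] by (auto simp: space_pair_measure)
    from I(1)[OF this]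
    show "ennreal (dKL (K1 t (fst \<omega>, H t \<omega>)) (K2 t (H t \<omega>))) = ennreal (?I (fst \<omega>, H t \<omega>))" by simp
  qed
  also have "\<dots> = (\<integral>\<^sup>+z. ennreal (?I z) \<partial>?J)"
    by (subst nn_integral_distr) measurable
  also have "\<dots> = ennreal (\<integral>z. ?I z \<partial>?J)"
    by (rule nn_integral_eq_integral[OF iI]) (auto intro!: AE_I2 I(2))
  finally show "(\<integral>\<^sup>+\<omega>. ennreal (dKL (K1 t (fst \<omega>, H t \<omega>)) (K2 t (H t \<omega>))) \<partial>Om) = ennreal r"
    unfolding rI .
  show "r \<ge> 0" unfolding rI[symmetric] by (rule integral_nonneg_AE) (auto intro!: AE_I2 I(2))
qed

theorem sum_expected_dKL:
  assumes C1: "\<And>t. is_cond_distr Om (P \<Otimes>\<^sub>M HS t) (\<lambda>\<omega>. (fst \<omega>, H t \<omega>)) (Y (Suc t)) (C1 t)"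
    and C2: "\<And>t. is_cond_distr Om (HS t) (H t) (Y (Suc t)) (C2 t)"
    and int: "\<And>t. integrable Om (\<lambda>\<omega>. ln (Z t (H t \<omega>)))"
  shows "(\<Sum>t<T. \<integral>\<^sup>+\<omega>. ennreal (dKL (C1 t (fst \<omega>, H t \<omega>)) (C2 t (H t \<omega>))) \<partial>Om) =
    ennreal (- (\<integral>\<omega>. ln (Z T (H T \<omega>)) \<partial>Om) - real T / 2)"
proof -
  let ?r = "\<lambda>t. (\<integral>\<omega>. ln (Z t (H t \<omega>)) \<partial>Om) - (\<integral>\<omega>. ln (Z (Suc t) (H (Suc t) \<omega>)) \<partial>Om) - 1 / 2"
  have "(\<integral>\<^sup>+\<omega>. ennreal (dKL (C1 t (fst \<omega>, H t \<omega>)) (C2 t (H t \<omega>))) \<partial>Om) = ennreal (?r t)" for t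
  proof -
    \<comment> \<open>Arbitrary versions of the conditional laws differ from the explicit kernels
      only on null sets, which the expectation does not see.\<close>
    have "AE z in distr Om (P \<Otimes>\<^sub>M HS t) (\<lambda>\<omega>. (fst \<omega>, H t \<omega>)). C1 t z = K1 t z"
      by (rule AE_is_cond_distr_unique[OF Om.P.prob_space_axioms _ C1 is_cond_distr_K1]) measurable
    then have 1: "AE \<omega> in Om. C1 t (fst \<omega>, H t \<omega>) = K1 t (fst \<omega>, H t \<omega>)"
      by (rule AE_distrD[rotated]) measurable
    have "AE h in distr Om (HS t) (H t). C2 t h = K2 t h"
      by (rule AE_is_cond_distr_unique[OF Om.P.prob_space_axioms _ C2 is_cond_distr_K2]) measurable
    then have 2: "AE \<omega> in Om. C2 t (H t \<omega>) = K2 t (H t \<omega>)"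
      by (rule AE_distrD[rotated]) measurable
    have "(\<integral>\<^sup>+\<omega>. ennreal (dKL (C1 t (fst \<omega>, H t \<omega>)) (C2 t (H t \<omega>))) \<partial>Om) =
        (\<integral>\<^sup>+\<omega>. ennreal (dKL (K1 t (fst \<omega>, H t \<omega>)) (K2 t (H t \<omega>))) \<partial>Om)"
      using 1 2 by (intro nn_integral_cong_AE) auto
    then show ?thesis using expected_dKL(1)[OF int int] by simp
  qed
  then have "(\<Sum>t<T. \<integral>\<^sup>+\<omega>. ennreal (dKL (C1 t (fst \<omega>, H t \<omega>)) (C2 t (H t \<omega>))) \<partial>Om) =
      (\<Sum>t<T. ennreal (?r t))"
    by simp
  also have "\<dots> = ennreal (\<Sum>t<T. ?r t)"
    using expected_dKL(2)[OF int int] by (intro sum_ennreal) simp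
  also have "(\<Sum>t<T. ?r t) = (\<integral>\<omega>. ln (Z 0 (H 0 \<omega>)) \<partial>Om) - (\<integral>\<omega>. ln (Z T (H T \<omega>)) \<partial>Om) - real T / 2"
    by (induction T) (auto simp: field_simps)
  \<comment> \<open>With no labels the exponent is an empty sum, so \<open>Z 0\<close> is 1.\<close>
  also have "(\<integral>\<omega>. ln (Z 0 (H 0 \<omega>)) \<partial>Om) = 0"
    by (simp add: Z_def G_def P.prob_space)
  finally show ?thesis by simp
qed

end

section \<open>Gaussian priors\<close>

text \<open>Jensen's inequality by way of the tangent to exp at minus the mean of U: it lies below
  exp, is affine in U and hence integrable, and its mean is the left-hand side.\<close>

lemma (in prob_space) exp_neg_integral_le:
  assumes U: "integrable M U" and z: "(\<integral>\<^sup>+x. ennreal (exp (- U x)) \<partial>M) = ennreal z" "z \<ge> 0"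
  shows "exp (- (\<integral>x. U x \<partial>M)) \<le> z"
proof -
  let ?u = "\<integral>x. U x \<partial>M"
  have [measurable]: "U \<in> borel_measurable M" using U by auto
  have i: "integrable M (\<lambda>x. exp (- U x))" by (rule integrableI_nonneg) (auto simp: z)
  have "exp (- ?u) = (\<integral>x. exp (- ?u) * (1 + ?u - U x) \<partial>M)"
    using U by (simp add: prob_space)
  also have "\<dots> \<le> (\<integral>x. exp (- U x) \<partial>M)"
  proof (rule integral_mono)
    fix x
    have "exp (- ?u) * (1 + ?u - U x) \<le> exp (- ?u) * exp (?u - U x)"
      using exp_ge_add_one_self[of "?u - U x"] by (intro mult_left_mono) (auto simp: algebra_simps)
    then show "exp (- ?u) * (1 + ?u - U x) \<le> exp (- U x)" by (simp add: exp_add[symmetric])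
  qed (use U i in auto)
  also have "\<dots> = z" using z by (subst integral_eq_nn_integral) auto
  finally show ?thesis .
qed

lemma (in gauss_family) nn_integral_GP_component:
  fixes \<phi> :: "real \<Rightarrow> ennreal"
  assumes "i \<in> I" and [measurable]: "\<phi> \<in> borel_measurable borel"
  shows "(\<integral>\<^sup>+x. \<phi> (x i) \<partial>GP) = (\<integral>\<^sup>+y. \<phi> y \<partial>gauss 0 (v i))"
proof -
  have "(\<integral>\<^sup>+y. \<phi> y \<partial>distr GP (gauss 0 (v i)) (\<lambda>x. x i)) = (\<integral>\<^sup>+x. \<phi> (x i) \<partial>GP)"
    using assms(1) measurable_component_singleton[OF assms(1), of "\<lambda>i. gauss 0 (v i)"]
    by (intro nn_integral_distr) auto
  then show ?thesis by (simp only: PiM_component[OF assms(1)])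
qed

lemma (in gauss_family) measurable_GP_component [measurable]:
  "i \<in> I \<Longrightarrow> (\<lambda>x. x i) \<in> borel_measurable GP"
  using measurable_component_singleton[of i I "\<lambda>i. gauss 0 (v i)"] by simp

section \<open>Mixing the true weights with an independent prior draw\<close>

locale gaussian_prior_regression = GF: gauss_family I v +
    gaussian_regression "PiM I (\<lambda>i. gauss 0 (v i))" XM f s2
  for I :: "'i set" and v :: "'i \<Rightarrow> real" and XM :: "'x measure" and f s2 +
  fixes a b :: real
  assumes ab: "a\<^sup>2 + b\<^sup>2 = 1" and b: "b > 0"
begin

definition mix :: "('i \<Rightarrow> real) \<Rightarrow> ('i \<Rightarrow> real) \<Rightarrow> 'i \<Rightarrow> real" where
  "mix \<theta> \<xi> = (\<lambda>i\<in>I. a * \<theta> i + b * \<xi> i)"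

lemma measurable_mix [measurable (raw)]:
  assumes [measurable]: "g \<in> M \<rightarrow>\<^sub>M GF.GP" "k \<in> M \<rightarrow>\<^sub>M GF.GP"
  shows "(\<lambda>x. mix (g x) (k x)) \<in> M \<rightarrow>\<^sub>M GF.GP"
  unfolding mix_def
proof (rule measurable_restrict)
  fix i assume i: "i \<in> I"
  note [measurable] = measurable_compose[OF assms(1) GF.measurable_GP_component[OF i]]
    measurable_compose[OF assms(2) GF.measurable_GP_component[OF i]]
  show "(\<lambda>x. a * g x i + b * k x i) \<in> M \<rightarrow>\<^sub>M gauss 0 (v i)" by simp
qed

text \<open>After the substitution \<open>mix\<close>, the integrand of \<open>Z\<close> is \<open>exp (- U)\<close> against the prior.\<close>
definition U :: "nat \<Rightarrow> ('i \<Rightarrow> real) \<Rightarrow> (nat \<Rightarrow> 'x) \<times> (nat \<Rightarrow> real) \<Rightarrow> ('i \<Rightarrow> real) \<Rightarrow> real" where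
  "U t \<theta> h \<xi> = G t (mix \<theta> \<xi>) h - card I * ln b - (\<Sum>i\<in>I. ((\<xi> i)\<^sup>2 - (a * \<theta> i + b * \<xi> i)\<^sup>2) / (2 * v i))"

text \<open>Here \<theta> is arbitrary and not tied to h; the true weights are inserted only
  afterwards. The terms of \<open>U\<close> other than \<open>G\<close> integrate to the relative
  entropy of the trial Gaussian to the prior.\<close>

lemma neg_ln_Z_le:
  assumes h: "h \<in> space (HS t)"
    and int: "integrable GF.GP (U t \<theta> h)"
  shows "- ln (Z t h) \<le> (\<integral>\<xi>. U t \<theta> h \<xi> \<partial>GF.GP)"
proof -
  have Z: "Z t h > 0" by (rule Z_pos[OF _ _ h]) auto
  have [measurable]: "(\<lambda>\<phi>. exp (- G t \<phi> h)) \<in> borel_measurable GF.GP"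
    by (rule measurable_exp_G[OF _ _ h]) auto
  have "ennreal (Z t h) = (\<integral>\<^sup>+\<phi>. ennreal (exp (- G t \<phi> h)) \<partial>GF.GP)"
    by (rule nn_integral_exp_G[OF _ _ h, symmetric]) auto
  also have "\<dots> = (\<integral>\<^sup>+\<xi>. ennreal (\<Prod>i\<in>I. b * exp (((\<xi> i)\<^sup>2 - (a * \<theta> i + b * \<xi> i)\<^sup>2) / (2 * v i))) *
      ennreal (exp (- G t (mix \<theta> \<xi>) h)) \<partial>GF.GP)"
    unfolding mix_def by (rule GF.nn_integral_GP_affine[OF _ b]) measurable
  also have "\<dots> = (\<integral>\<^sup>+\<xi>. ennreal (exp (- U t \<theta> h \<xi>)) \<partial>GF.GP)"
  proof (rule nn_integral_cong)
    fix \<xi>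
    have "(\<Prod>i\<in>I. b * exp (((\<xi> i)\<^sup>2 - (a * \<theta> i + b * \<xi> i)\<^sup>2) / (2 * v i))) =
      (\<Prod>i\<in>I. exp (ln b + ((\<xi> i)\<^sup>2 - (a * \<theta> i + b * \<xi> i)\<^sup>2) / (2 * v i)))"
      using b by (simp add: exp_add)
    also have "\<dots> = exp (\<Sum>i\<in>I. ln b + ((\<xi> i)\<^sup>2 - (a * \<theta> i + b * \<xi> i)\<^sup>2) / (2 * v i))"
      by (rule exp_sum[symmetric]) simp
    finally have "(\<Prod>i\<in>I. b * exp (((\<xi> i)\<^sup>2 - (a * \<theta> i + b * \<xi> i)\<^sup>2) / (2 * v i))) *
        exp (- G t (mix \<theta> \<xi>) h) =
        exp (- U t \<theta> h \<xi>)"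
      by (simp add: U_def exp_add[symmetric] sum.distrib)
    then show "ennreal (\<Prod>i\<in>I. b * exp (((\<xi> i)\<^sup>2 - (a * \<theta> i + b * \<xi> i)\<^sup>2) / (2 * v i))) *
      ennreal (exp (- G t (mix \<theta> \<xi>) h)) = ennreal (exp (- U t \<theta> h \<xi>))"
      by (simp add: ennreal_mult''[symmetric])
  qed
  finally have "exp (- (\<integral>\<xi>. U t \<theta> h \<xi> \<partial>GF.GP)) \<le> Z t h"
    using Z by (intro GF.P.exp_neg_integral_le[OF int]) auto
  then have "- (\<integral>\<xi>. U t \<theta> h \<xi> \<partial>GF.GP) \<le> ln (Z t h)" by (simp only: ln_ge_iff[OF Z])
  then show ?thesis by linarith
qed

lemma nn_integral_Om_X:
  assumes [measurable]: "(\<lambda>z. g (fst z) (snd z)) \<in> borel_measurable (GF.GP \<Otimes>\<^sub>M XM)"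
  shows "(\<integral>\<^sup>+\<omega>. g (fst \<omega>) (fst (snd \<omega>) t) \<partial>Om) = (\<integral>\<^sup>+\<theta>. \<integral>\<^sup>+x. g \<theta> x \<partial>XM \<partial>GF.GP)"
proof -
  have m: "(\<lambda>\<omega>. g (fst \<omega>) (fst (snd \<omega>) t)) \<in> borel_measurable Om"
    using measurable_compose[OF _ assms, of "\<lambda>\<omega>. (fst \<omega>, fst (snd \<omega>) t)" Om] by simp
  have "(\<integral>\<^sup>+\<omega>. g (fst \<omega>) (fst (snd \<omega>) t) \<partial>Om) = (\<integral>\<^sup>+\<theta>. \<integral>\<^sup>+x. g \<theta> (x t) \<partial>Xs \<partial>GF.GP)"
    unfolding nn_integral_Om[OF m] by (simp add: WP.P.emeasure_space_1)
  also have "\<dots> = (\<integral>\<^sup>+\<theta>. \<integral>\<^sup>+x. g \<theta> x \<partial>XM \<partial>GF.GP)"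
  proof (rule nn_integral_cong)
    fix \<theta> assume \<theta>: "\<theta> \<in> space GF.GP"
    have "g \<theta> \<in> borel_measurable XM"
      using measurable_compose[OF measurable_Pair1'[OF \<theta>] assms] by simp
    then have "(\<integral>\<^sup>+x. g \<theta> x \<partial>distr Xs XM (\<lambda>x. x t)) = (\<integral>\<^sup>+x. g \<theta> (x t) \<partial>Xs)"
      by (intro nn_integral_distr) auto
    then show "(\<integral>\<^sup>+x. g \<theta> (x t) \<partial>Xs) = (\<integral>\<^sup>+x. g \<theta> x \<partial>XM)"
      by (simp add: XP.PiM_component)
  qed
  finally show ?thesis .
qed

definition distortion :: ennreal where
  "distortion = (\<integral>\<^sup>+\<theta>. \<integral>\<^sup>+x. \<integral>\<^sup>+\<xi>. ennreal ((f \<theta> x - f (mix \<theta> \<xi>) x)\<^sup>2) \<partial>GF.GP \<partial>XM \<partial>GF.GP)"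

text \<open>The residual of the mixed network is the difference of the two outputs plus the fresh
  noise. That noise is centred and independent of weights and input, so the squares add.\<close>

lemma nn_integral_residual:
  "(\<integral>\<^sup>+\<omega>. \<integral>\<^sup>+\<xi>. ennreal ((Y (Suc t) \<omega> - f (mix (fst \<omega>) \<xi>) (fst (snd \<omega>) t))\<^sup>2) \<partial>GF.GP \<partial>Om) =
      distortion + ennreal s2"
proof -
  interpret pair_sigma_finite "gauss 0 s2" GF.GP ..
  let ?\<Delta> = "\<lambda>\<theta> x \<xi>. f \<theta> x - f (mix \<theta> \<xi>) x"
  have 1: "(\<lambda>x. \<integral>\<^sup>+\<xi>. ennreal ((?\<Delta> (fst (fst x)) (fst (snd (fst x)) t) \<xi> + snd x * 1)\<^sup>2) \<partial>GF.GP) \<in>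
      borel_measurable ((GF.GP \<Otimes>\<^sub>M HS t) \<Otimes>\<^sub>M borel)"
    by measurable
  have "(\<integral>\<^sup>+\<omega>. \<integral>\<^sup>+\<xi>. ennreal ((Y (Suc t) \<omega> - f (mix (fst \<omega>) \<xi>) (fst (snd \<omega>) t))\<^sup>2) \<partial>GF.GP \<partial>Om) =
      (\<integral>\<^sup>+\<omega>. \<integral>\<^sup>+\<xi>. ennreal ((?\<Delta> (fst \<omega>) (fst (snd \<omega>) t) \<xi> + snd (snd \<omega>) (Suc t) * 1)\<^sup>2) \<partial>GF.GP \<partial>Om)"
    by (simp add: Y_def algebra_simps)
  also have "\<dots> = (\<integral>\<^sup>+\<omega>. \<integral>\<^sup>+w. \<integral>\<^sup>+\<xi>. ennreal ((?\<Delta> (fst \<omega>) (fst (snd \<omega>) t) \<xi> + w *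
      1)\<^sup>2) \<partial>GF.GP \<partial>gauss 0 s2 \<partial>Om)"
    using nn_integral_H_W[OF 1] by simp
  also have "\<dots> = (\<integral>\<^sup>+\<theta>. \<integral>\<^sup>+x. \<integral>\<^sup>+w. \<integral>\<^sup>+\<xi>. ennreal ((?\<Delta> \<theta> x \<xi> + w * 1)\<^sup>2) \<partial>GF.GP \<partial>gauss 0 s2 \<partial>XM \<partial>GF.GP)"
    by (rule nn_integral_Om_X) measurable
  also have "\<dots> = (\<integral>\<^sup>+\<theta>. \<integral>\<^sup>+x. (\<integral>\<^sup>+\<xi>. ennreal ((?\<Delta> \<theta> x \<xi>)\<^sup>2) \<partial>GF.GP) + ennreal s2 \<partial>XM \<partial>GF.GP)"
  proof (rule nn_integral_cong, rule nn_integral_cong)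
    fix \<theta> x assume [measurable]: "\<theta> \<in> space GF.GP" "x \<in> space XM"
    have [measurable]: "?\<Delta> \<theta> x \<in> borel_measurable GF.GP" by measurable
    have "(\<integral>\<^sup>+w. \<integral>\<^sup>+\<xi>. ennreal ((?\<Delta> \<theta> x \<xi> + w * 1)\<^sup>2) \<partial>GF.GP \<partial>gauss 0 s2) =
        (\<integral>\<^sup>+\<xi>. \<integral>\<^sup>+w. ennreal ((?\<Delta> \<theta> x \<xi> + w * 1)\<^sup>2) \<partial>gauss 0 s2 \<partial>GF.GP)"
      by (rule Fubini'[symmetric]) measurable
    also have "\<dots> = (\<integral>\<^sup>+\<xi>. ennreal ((?\<Delta> \<theta> x \<xi>)\<^sup>2) + ennreal s2 \<partial>GF.GP)"
      by (subst nn_integral_gauss_square[OF s2]) simp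
    also have "\<dots> = (\<integral>\<^sup>+\<xi>. ennreal ((?\<Delta> \<theta> x \<xi>)\<^sup>2) \<partial>GF.GP) + ennreal s2"
      by (subst nn_integral_add) (auto simp: GF.P.emeasure_space_1)
    finally show "(\<integral>\<^sup>+w. \<integral>\<^sup>+\<xi>. ennreal ((?\<Delta> \<theta> x \<xi> + w * 1)\<^sup>2) \<partial>GF.GP \<partial>gauss 0 s2) =
      (\<integral>\<^sup>+\<xi>. ennreal ((?\<Delta> \<theta> x \<xi>)\<^sup>2) \<partial>GF.GP) + ennreal s2" .
  qed
  also have "\<dots> = (\<integral>\<^sup>+\<theta>. (\<integral>\<^sup>+x. \<integral>\<^sup>+\<xi>. ennreal ((?\<Delta> \<theta> x \<xi>)\<^sup>2) \<partial>GF.GP \<partial>XM) + ennreal s2 \<partial>GF.GP)"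
  proof (rule nn_integral_cong)
    fix \<theta> assume [measurable]: "\<theta> \<in> space GF.GP"
    show "(\<integral>\<^sup>+x. (\<integral>\<^sup>+\<xi>. ennreal ((?\<Delta> \<theta> x \<xi>)\<^sup>2) \<partial>GF.GP) + ennreal s2 \<partial>XM) =
        (\<integral>\<^sup>+x. \<integral>\<^sup>+\<xi>. ennreal ((?\<Delta> \<theta> x \<xi>)\<^sup>2) \<partial>GF.GP \<partial>XM) + ennreal s2"
      by (subst nn_integral_add) (auto simp: XM.emeasure_space_1)
  qed
  also have "\<dots> = distortion + ennreal s2"
    unfolding distortion_def by (subst nn_integral_add) (auto simp: GF.P.emeasure_space_1)
  finally show ?thesis .
qed

sublocale OP: pair_prob_space Om GF.GP ..

lemma measurable_GU [measurable]:
  "(\<lambda>z. G t (mix (fst (fst z)) (snd z)) (H t (fst z))) \<in> borel_measurable (Om \<Otimes>\<^sub>M GF.GP)"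
proof -
  have "(\<lambda>z. (mix (fst (fst z)) (snd z), H t (fst z))) \<in> Om \<Otimes>\<^sub>M GF.GP \<rightarrow>\<^sub>M GF.GP \<Otimes>\<^sub>M HS t"
    by measurable
  from measurable_compose[OF this measurable_G[of t t t]] show ?thesis by simp
qed

lemma nn_integral_GU:
  "(\<integral>\<^sup>+z. ennreal (G t (mix (fst (fst z)) (snd z)) (H t (fst z))) \<partial>(Om \<Otimes>\<^sub>M GF.GP)) =
    of_nat t * ((distortion + ennreal s2) / ennreal (2 * s2))"
proof -
  have H: "G t \<theta> (H t \<omega>) = (\<Sum>s<t. (Y (Suc s) \<omega> - f \<theta> (fst (snd \<omega>) s))\<^sup>2 / (2 * s2))" for \<theta> \<omega>
  proof -
    have "G t \<theta> (H t \<omega>) = (\<Sum>s=Suc 0..t. (Y s \<omega> - f \<theta> (fst (snd \<omega>) (s - 1)))\<^sup>2 / (2 * s2))"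
      unfolding G_def by (rule sum.cong) (auto simp: H_def)
    also have "\<dots> = (\<Sum>s<t. (Y (Suc s) \<omega> - f \<theta> (fst (snd \<omega>) s))\<^sup>2 / (2 * s2))"
      by (rule sum.reindex_bij_witness[of _ Suc "\<lambda>s. s - 1"]) auto
    finally show ?thesis .
  qed
  have "(\<integral>\<^sup>+z. ennreal (G t (mix (fst (fst z)) (snd z)) (H t (fst z))) \<partial>(Om \<Otimes>\<^sub>M GF.GP)) =
      (\<integral>\<^sup>+\<omega>. \<integral>\<^sup>+\<xi>. ennreal (G t (mix (fst \<omega>) \<xi>) (H t \<omega>)) \<partial>GF.GP \<partial>Om)"
    by (subst GF.P.nn_integral_fst[symmetric]) auto
  also have "\<dots> = (\<integral>\<^sup>+\<omega>. \<integral>\<^sup>+\<xi>. (\<Sum>s<t. ennreal ((Y (Suc s) \<omega> - f (mix (fst \<omega>) \<xi>) (fst (snd \<omega>) s))\<^sup>2) / ennreal (2 * s2)) \<partial>GF.GP \<partial>Om)"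
    unfolding H using s2 by (subst sum_ennreal[symmetric]) (auto simp: divide_ennreal)
  also have "\<dots> = (\<integral>\<^sup>+\<omega>. (\<Sum>s<t. \<integral>\<^sup>+\<xi>. ennreal ((Y (Suc s) \<omega> - f (mix (fst \<omega>) \<xi>) (fst (snd \<omega>) s))\<^sup>2) / ennreal (2 * s2) \<partial>GF.GP) \<partial>Om)"
  proof (rule nn_integral_cong, rule nn_integral_sum)
    fix \<omega> s assume [measurable]: "\<omega> \<in> space Om"
    show "(\<lambda>\<xi>. ennreal ((Y (Suc s) \<omega> - f (mix (fst \<omega>) \<xi>) (fst (snd \<omega>) s))\<^sup>2) / ennreal (2 * s2)) \<in>
        borel_measurable GF.GP"
      by measurable
  qed
  also have "\<dots> = (\<Sum>s<t. \<integral>\<^sup>+\<omega>. \<integral>\<^sup>+\<xi>. ennreal ((Y (Suc s) \<omega> - f (mix (fst \<omega>) \<xi>) (fst (snd \<omega>) s))\<^sup>2) / ennreal (2 * s2) \<partial>GF.GP \<partial>Om)"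
    by (rule nn_integral_sum) measurable
  also have "\<dots> = (\<Sum>s<t. (distortion + ennreal s2) / ennreal (2 * s2))"
  proof (rule sum.cong[OF refl])
    fix s
    have "(\<integral>\<^sup>+\<omega>. \<integral>\<^sup>+\<xi>. ennreal ((Y (Suc s) \<omega> - f (mix (fst \<omega>) \<xi>) (fst (snd \<omega>) s))\<^sup>2) / ennreal (2 *
        s2) \<partial>GF.GP \<partial>Om) =
        (\<integral>\<^sup>+\<omega>. (\<integral>\<^sup>+\<xi>. ennreal ((Y (Suc s) \<omega> - f (mix (fst \<omega>) \<xi>) (fst (snd \<omega>) s))\<^sup>2) \<partial>GF.GP) / ennreal (2 * s2) \<partial>Om)"
    proof (rule nn_integral_cong)
      fix \<omega> assume [measurable]: "\<omega> \<in> space Om"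
      show "(\<integral>\<^sup>+\<xi>. ennreal ((Y (Suc s) \<omega> - f (mix (fst \<omega>) \<xi>) (fst (snd \<omega>) s))\<^sup>2) / ennreal (2 *
          s2) \<partial>GF.GP) =
         (\<integral>\<^sup>+\<xi>. ennreal ((Y (Suc s) \<omega> - f (mix (fst \<omega>) \<xi>) (fst (snd \<omega>) s))\<^sup>2) \<partial>GF.GP) / ennreal (2 *
             s2)"
        by (rule nn_integral_divide) measurable
    qed
    also have "\<dots> = (distortion + ennreal s2) / ennreal (2 * s2)"
      unfolding nn_integral_residual[of s, symmetric] by (rule nn_integral_divide) measurable
    finally show "(\<integral>\<^sup>+\<omega>. \<integral>\<^sup>+\<xi>. ennreal ((Y (Suc s) \<omega> - f (mix (fst \<omega>) \<xi>) (fst (snd \<omega>) s))\<^sup>2) / ennreal (2 * s2) \<partial>GF.GP \<partial>Om) =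
      (distortion + ennreal s2) / ennreal (2 * s2)" .
  qed
  finally show ?thesis by simp
qed

text \<open>Both means are v i because a^2 + b^2 = 1. Equality of these second moments is all that
  the cancellation of the Gaussian weights requires.\<close>

lemma has_bochner_integral_prior_squares:
  assumes i: "i \<in> I"
  shows "has_bochner_integral (Om \<Otimes>\<^sub>M GF.GP) (\<lambda>z. (snd z i)\<^sup>2) (v i)"
    and "has_bochner_integral (Om \<Otimes>\<^sub>M GF.GP) (\<lambda>z. (a * fst (fst z) i + b * snd z i)\<^sup>2) (v i)"
proof -
  note [measurable] = GF.measurable_GP_component[OF i]
  have v: "v i > 0" by (rule GF.v_pos)
  have sq: "(\<integral>\<^sup>+x. ennreal ((B + x i * A)\<^sup>2) \<partial>GF.GP) =
      ennreal (B\<^sup>2) + ennreal (v i) * ennreal (A\<^sup>2)" for A B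
    using GF.nn_integral_GP_component[OF i, of "\<lambda>y. ennreal ((B + y * A)\<^sup>2)"]
      nn_integral_gauss_square[OF v] by simp
  have 1: "(\<integral>\<^sup>+z. ennreal ((snd z i)\<^sup>2) \<partial>(Om \<Otimes>\<^sub>M GF.GP)) = ennreal (v i)"
    using sq[of 0 1] by (subst GF.P.nn_integral_fst[symmetric]) (auto simp: Om.P.emeasure_space_1)
  show "has_bochner_integral (Om \<Otimes>\<^sub>M GF.GP) (\<lambda>z. (snd z i)\<^sup>2) (v i)"
    by (rule has_bochner_integral_nn_integral) (use 1 v in auto)
  have "(\<integral>\<^sup>+z. ennreal ((a * fst (fst z) i + b * snd z i)\<^sup>2) \<partial>(Om \<Otimes>\<^sub>M GF.GP)) =
     (\<integral>\<^sup>+\<omega>. \<integral>\<^sup>+\<xi>. ennreal ((a * fst \<omega> i + \<xi> i * b)\<^sup>2) \<partial>GF.GP \<partial>Om)"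
    by (subst GF.P.nn_integral_fst[symmetric]) (auto simp: mult.commute)
  also have "\<dots> = (\<integral>\<^sup>+\<omega>. ennreal ((0 + fst \<omega> i * a)\<^sup>2) + ennreal (v i) * ennreal (b\<^sup>2) \<partial>Om)"
    by (simp only: sq) (simp add: mult.commute)
  also have "\<dots> = (\<integral>\<^sup>+\<omega>. ennreal ((0 + fst \<omega> i * a)\<^sup>2) \<partial>Om) + ennreal (v i) * ennreal (b\<^sup>2)"
    by (subst nn_integral_add) (auto simp: Om.P.emeasure_space_1)
  also have "(\<integral>\<^sup>+\<omega>. ennreal ((0 + fst \<omega> i * a)\<^sup>2) \<partial>Om) = ennreal (v i) * ennreal (a\<^sup>2)"
    using nn_integral_Om_X[of "\<lambda>\<theta> x. ennreal ((0 + \<theta> i * a)\<^sup>2)" 0] sq[of 0 a]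
    by (simp add: XM.emeasure_space_1)
  also have "ennreal (v i) * ennreal (a\<^sup>2) + ennreal (v i) * ennreal (b\<^sup>2) =
      ennreal (v i * (a\<^sup>2 + b\<^sup>2))"
    using v by (simp add: ennreal_mult'[symmetric] ennreal_plus[symmetric] distrib_left del: ennreal_plus)
  finally have 2: "(\<integral>\<^sup>+z. ennreal ((a * fst (fst z) i + b * snd z i)\<^sup>2) \<partial>(Om \<Otimes>\<^sub>M GF.GP)) =
      ennreal (v i)"
    by (simp add: ab)
  show "has_bochner_integral (Om \<Otimes>\<^sub>M GF.GP) (\<lambda>z. (a * fst (fst z) i + b * snd z i)\<^sup>2) (v i)"
    by (rule has_bochner_integral_nn_integral) (use 2 v in auto)
qed

text \<open>Integrability and bound have one source: \<open>- ln Z\<close> lies between 0 and the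
  \<xi>-mean of \<open>U\<close> taken at the true weights, and \<open>U\<close> is integrable over
  the sample space times the independent copy.\<close>

lemma ln_Z_bounds:
  assumes C: "distortion \<le> ennreal C" "C \<ge> 0"
  shows "integrable Om (\<lambda>\<omega>. ln (Z t (H t \<omega>)))"
    and "- (\<integral>\<omega>. ln (Z t (H t \<omega>)) \<partial>Om) \<le> real t * (C + s2) / (2 * s2) - card I * ln b"
proof -
  let ?M = "Om \<Otimes>\<^sub>M GF.GP"
  let ?G = "\<lambda>z. G t (mix (fst (fst z)) (snd z)) (H t (fst z))"
  let ?Q = "\<lambda>z. \<Sum>i\<in>I. ((snd z i)\<^sup>2 - (a * fst (fst z) i + b * snd z i)\<^sup>2) / (2 * v i)"
  let ?U = "\<lambda>z. U t (fst (fst z)) (H t (fst z)) (snd z)"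
  have le: "(\<integral>\<^sup>+z. ennreal (?G z) \<partial>?M) \<le> ennreal (real t * (C + s2) / (2 * s2))"
  proof -
    have "(\<integral>\<^sup>+z. ennreal (?G z) \<partial>?M) \<le> of_nat t * ((ennreal C + ennreal s2) / ennreal (2 * s2))"
      unfolding nn_integral_GU using C by (intro mult_left_mono divide_right_mono_ennreal add_right_mono) auto
    also have "\<dots> = ennreal (real t * (C + s2) / (2 * s2))"
      using C s2 by (simp add: ennreal_plus[symmetric] divide_ennreal ennreal_of_nat_eq_real_of_nat ennreal_mult'[symmetric] del: ennreal_plus)
    finally show ?thesis .
  qed
  have iG: "integrable ?M ?G"
    by (rule integrableI_nonneg) (use le G_nonneg in \<open>auto simp: le_less_trans\<close>)
  have "ennreal (\<integral>z. ?G z \<partial>?M) \<le> ennreal (real t * (C + s2) / (2 * s2))"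
    using le nn_integral_eq_integral[OF iG] G_nonneg by simp
  then have rG: "(\<integral>z. ?G z \<partial>?M) \<le> real t * (C + s2) / (2 * s2)"
    using C s2 by (subst (asm) ennreal_le_iff) auto
  \<comment> \<open>The two squares have equal means, so the Gaussian weights contribute 0 although
    they do not vanish pointwise.\<close>
  have Q: "has_bochner_integral ?M ?Q (\<Sum>i\<in>I. (v i - v i) / (2 * v i))"
    by (intro has_bochner_integral_sum has_bochner_integral_divide_zero has_bochner_integral_diff
        has_bochner_integral_prior_squares)
  have U: "?U = (\<lambda>z. ?G z - card I * ln b - ?Q z)" by (simp add: U_def)
  have iU: "integrable ?M ?U"
    unfolding U using iG Q by (auto simp: has_bochner_integral_iff)
  have "(\<integral>z. ?U z \<partial>?M) = (\<integral>z. ?G z \<partial>?M) - card I * ln b"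
    unfolding U using iG Q by (simp add: has_bochner_integral_iff OP.P.prob_space)
  then have rU: "(\<integral>z. ?U z \<partial>?M) \<le> real t * (C + s2) / (2 * s2) - card I * ln b"
    using rG by simp
  let ?u = "\<lambda>\<omega>. \<integral>\<xi>. U t (fst \<omega>) (H t \<omega>) \<xi> \<partial>GF.GP"
  have iu: "integrable Om ?u" using OP.integrable_fst'[OF iU] by simp
  have ru: "(\<integral>\<omega>. ?u \<omega> \<partial>Om) = (\<integral>z. ?U z \<partial>?M)" using OP.integral_fst'[OF iU] by simp
  have [measurable]: "Z t \<in> borel_measurable (HS t)" by (rule measurable_Z) auto
  have HS: "H t \<omega> \<in> space (HS t)" if "\<omega> \<in> space Om" for \<omega>
    using measurable_space[OF measurable_H that] .
  have Z: "0 < Z t (H t \<omega>)" "Z t (H t \<omega>) \<le> 1" if "\<omega> \<in> space Om" for \<omega>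
    using Z_pos[OF _ _ HS[OF that]] Z_le_1[OF _ _ HS[OF that]] by auto
  \<comment> \<open>Joint integrability of \<open>U\<close> yields integrability in \<xi> only for
    almost every sample, which is enough for the expectation.\<close>
  have AE: "AE \<omega> in Om. - ln (Z t (H t \<omega>)) \<le> ?u \<omega>"
    using OP.AE_integrable_fst'[OF iU] AE_space
  proof eventually_elim
    fix \<omega> assume "integrable GF.GP (\<lambda>\<xi>. U t (fst (fst (\<omega>, \<xi>))) (H t (fst (\<omega>, \<xi>))) (snd (\<omega>, \<xi>)))"
      and \<omega>: "\<omega> \<in> space Om"
    then have "integrable GF.GP (U t (fst \<omega>) (H t \<omega>))" by simp
    then show "- ln (Z t (H t \<omega>)) \<le> ?u \<omega>"
      using \<omega> by (intro neg_ln_Z_le HS) (auto simp: space_pair_measure)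
  qed
  show iZ: "integrable Om (\<lambda>\<omega>. ln (Z t (H t \<omega>)))"
  proof (rule Bochner_Integration.integrable_bound[OF iu])
    show "AE \<omega> in Om. norm (ln (Z t (H t \<omega>))) \<le> norm (?u \<omega>)"
      using AE AE_space
    proof eventually_elim
      fix \<omega> assume "- ln (Z t (H t \<omega>)) \<le> ?u \<omega>" "\<omega> \<in> space Om"
      moreover from this Z[of \<omega>] have "ln (Z t (H t \<omega>)) \<le> 0" by simp
      ultimately show "norm (ln (Z t (H t \<omega>))) \<le> norm (?u \<omega>)" by simp
    qed
  qed measurable
  have "- (\<integral>\<omega>. ln (Z t (H t \<omega>)) \<partial>Om) = (\<integral>\<omega>. - ln (Z t (H t \<omega>)) \<partial>Om)" by simp
  also have "\<dots> \<le> (\<integral>\<omega>. ?u \<omega> \<partial>Om)"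
    using iZ iu AE by (intro integral_mono_AE) auto
  also note ru
  also note rU
  finally show "- (\<integral>\<omega>. ln (Z t (H t \<omega>)) \<partial>Om) \<le> real t * (C + s2) / (2 * s2) - card I * ln b" .
qed

theorem sum_expected_dKL_le:
  assumes C1: "\<And>t. is_cond_distr Om (GF.GP \<Otimes>\<^sub>M HS t) (\<lambda>\<omega>. (fst \<omega>, H t \<omega>)) (Y (Suc t)) (C1 t)"
    and C2: "\<And>t. is_cond_distr Om (HS t) (H t) (Y (Suc t)) (C2 t)"
    and C: "distortion \<le> ennreal C" "C \<ge> 0"
  shows "(\<Sum>t<T. \<integral>\<^sup>+\<omega>. ennreal (dKL (C1 t (fst \<omega>, H t \<omega>)) (C2 t (H t \<omega>))) \<partial>Om) \<le>
    ennreal (real T * C / (2 * s2) - card I * ln b)"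
  unfolding sum_expected_dKL[OF C1 C2 ln_Z_bounds(1)[OF C]]
proof (rule ennreal_leI)
  \<comment> \<open>The noise share \<open>T * s2 / (2 * s2)\<close> of the bound is T/2 and cancels
    the one half per step in the telescoped sum.\<close>
  show "- (\<integral>\<omega>. ln (Z T (H T \<omega>)) \<partial>Om) - real T / 2 \<le> real T * C / (2 * s2) - card I * ln b"
    using ln_Z_bounds(2)[OF C, of T] s2 by (simp add: field_simps)
qed

end

section \<open>Random relu networks\<close>

text \<open>Two passes of the row rule. For fixed \<theta> the \<xi>-row is centred and independent
  of the \<theta>-part, which then serves as the offset; that part is afterwards expanded in its own
  row.\<close>

lemma (in gauss_family) nn_integral_GP_square_row2:
  assumes J: "finite J" "J \<subseteq> I"
    and mA: "\<And>j. j \<in> J \<Longrightarrow> (\<lambda>z. A j (fst z) (snd z)) \<in> borel_measurable (GP \<Otimes>\<^sub>M GP)"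
    and mC: "\<And>j. j \<in> J \<Longrightarrow> (\<lambda>z. C j (fst z) (snd z)) \<in> borel_measurable (GP \<Otimes>\<^sub>M GP)"
    and A: "\<And>j k \<theta> \<xi> y. j \<in> J \<Longrightarrow> k \<in> J \<Longrightarrow> A j (\<theta>(k := y)) \<xi> = A j \<theta> \<xi>"
      "\<And>j k \<theta> \<xi> y. j \<in> J \<Longrightarrow> k \<in> J \<Longrightarrow> A j \<theta> (\<xi>(k := y)) = A j \<theta> \<xi>"
    and C: "\<And>j k \<theta> \<xi> y. j \<in> J \<Longrightarrow> k \<in> J \<Longrightarrow> C j \<theta> (\<xi>(k := y)) = C j \<theta> \<xi>"
  shows "(\<integral>\<^sup>+\<theta>. \<integral>\<^sup>+\<xi>. ennreal ((\<Sum>j\<in>J. \<theta> j * A j \<theta> \<xi> + \<xi> j * C j \<theta> \<xi>)\<^sup>2) \<partial>GP \<partial>GP) =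
    (\<Sum>j\<in>J. ennreal (v j) * ((\<integral>\<^sup>+\<theta>. \<integral>\<^sup>+\<xi>. ennreal ((A j \<theta> \<xi>)\<^sup>2) \<partial>GP \<partial>GP) +
      (\<integral>\<^sup>+\<theta>. \<integral>\<^sup>+\<xi>. ennreal ((C j \<theta> \<xi>)\<^sup>2) \<partial>GP \<partial>GP)))"
proof -
  interpret PP: pair_sigma_finite GP GP ..
  note [measurable] = mA mC
  have [measurable]: "(\<lambda>x. x j) \<in> borel_measurable GP" if "j \<in> J" for j
    using that J by (intro measurable_GP_component) auto
  have [measurable]: "(\<lambda>\<xi>. \<integral>\<^sup>+\<theta>. ennreal ((A j \<theta> \<xi>)\<^sup>2) \<partial>GP) \<in> borel_measurable GP" if "j \<in> J" for j
  proof -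
    have "(\<lambda>z. A j (snd z) (fst z)) \<in> borel_measurable (GP \<Otimes>\<^sub>M GP)"
      using measurable_compose[OF measurable_pair_swap' mA[OF that]] by (simp add: case_prod_unfold)
    then show ?thesis by (intro P.borel_measurable_nn_integral) (simp add: case_prod_unfold)
  qed
  let ?B = "\<lambda>\<theta> \<xi>. \<Sum>j\<in>J. \<theta> j * A j \<theta> \<xi>"
  have mB [measurable]: "(\<lambda>z. ?B (fst z) (snd z)) \<in> borel_measurable (GP \<Otimes>\<^sub>M GP)"
    by measurable
  have fixl: "(\<lambda>\<xi>. F \<theta> \<xi>) \<in> borel_measurable GP" 
    if "(\<lambda>z. F (fst z) (snd z)) \<in> borel_measurable (GP \<Otimes>\<^sub>M GP)" "\<theta> \<in>
        space GP" for F :: "_ \<Rightarrow> _ \<Rightarrow> real" and \<theta>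
    using measurable_compose[OF measurable_Pair1'[OF that(2)] that(1)] by simp
  have fixr: "(\<lambda>\<theta>. F \<theta> \<xi>) \<in> borel_measurable GP" 
    if "(\<lambda>z. F (fst z) (snd z)) \<in> borel_measurable (GP \<Otimes>\<^sub>M GP)" "\<xi> \<in>
        space GP" for F :: "_ \<Rightarrow> _ \<Rightarrow> real" and \<xi>
    using measurable_compose[OF measurable_Pair2'[OF that(2)] that(1)] by simp
  have "(\<integral>\<^sup>+\<theta>. \<integral>\<^sup>+\<xi>. ennreal ((\<Sum>j\<in>J. \<theta> j * A j \<theta> \<xi> + \<xi> j * C j \<theta> \<xi>)\<^sup>2) \<partial>GP \<partial>GP) =
      (\<integral>\<^sup>+\<theta>. (\<integral>\<^sup>+\<xi>. ennreal ((?B \<theta> \<xi>)\<^sup>2) \<partial>GP) +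
        (\<Sum>j\<in>J. ennreal (v j) * (\<integral>\<^sup>+\<xi>. ennreal ((C j \<theta> \<xi>)\<^sup>2) \<partial>GP)) \<partial>GP)"
  proof (rule nn_integral_cong)
    fix \<theta> assume \<theta>: "\<theta> \<in> space GP"
    show "(\<integral>\<^sup>+\<xi>. ennreal ((\<Sum>j\<in>J. \<theta> j * A j \<theta> \<xi> + \<xi> j * C j \<theta> \<xi>)\<^sup>2) \<partial>GP) =
      (\<integral>\<^sup>+\<xi>. ennreal ((?B \<theta> \<xi>)\<^sup>2) \<partial>GP) + (\<Sum>j\<in>J. ennreal (v j) * (\<integral>\<^sup>+\<xi>. ennreal ((C j \<theta> \<xi>)\<^sup>2) \<partial>GP))"
      unfolding sum.distrib
    proof (rule nn_integral_GP_square_row[OF J])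
      show "?B \<theta> \<in> borel_measurable GP" by (rule fixl[OF mB \<theta>])
      show "C j \<theta> \<in> borel_measurable GP" if "j \<in> J" for j by (rule fixl[OF mC \<theta>]) fact
      show "?B \<theta> (\<xi>(k := y)) = ?B \<theta> \<xi>" if "k \<in> J" for k \<xi> y
        using that by (intro sum.cong refl) (simp only: A)
    qed (rule C)
  qed
  also have "\<dots> = (\<integral>\<^sup>+\<theta>. \<integral>\<^sup>+\<xi>. ennreal ((?B \<theta> \<xi>)\<^sup>2) \<partial>GP \<partial>GP) +
      (\<integral>\<^sup>+\<theta>. (\<Sum>j\<in>J. ennreal (v j) * (\<integral>\<^sup>+\<xi>. ennreal ((C j \<theta> \<xi>)\<^sup>2) \<partial>GP)) \<partial>GP)"
    by (rule nn_integral_add) measurable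
  also have "(\<integral>\<^sup>+\<theta>. (\<Sum>j\<in>J. ennreal (v j) * (\<integral>\<^sup>+\<xi>. ennreal ((C j \<theta> \<xi>)\<^sup>2) \<partial>GP)) \<partial>GP) =
      (\<Sum>j\<in>J. ennreal (v j) * (\<integral>\<^sup>+\<theta>. \<integral>\<^sup>+\<xi>. ennreal ((C j \<theta> \<xi>)\<^sup>2) \<partial>GP \<partial>GP))"
    by (subst nn_integral_sum, measurable, intro sum.cong refl nn_integral_cmult) measurable
  \<comment> \<open>Tonelli puts \<theta> innermost, so that the row rule applies to the
    \<theta>-weights with \<xi> frozen and offset 0.\<close>
  also have "(\<integral>\<^sup>+\<theta>. \<integral>\<^sup>+\<xi>. ennreal ((?B \<theta> \<xi>)\<^sup>2) \<partial>GP \<partial>GP) = (\<integral>\<^sup>+\<xi>. \<integral>\<^sup>+\<theta>. ennreal ((?B \<theta> \<xi>)\<^sup>2) \<partial>GP \<partial>GP)"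
    by (rule PP.Fubini'[symmetric]) (simp add: case_prod_unfold)
  also have "\<dots> = (\<integral>\<^sup>+\<xi>. (\<Sum>j\<in>J. ennreal (v j) * (\<integral>\<^sup>+\<theta>. ennreal ((A j \<theta> \<xi>)\<^sup>2) \<partial>GP)) \<partial>GP)"
  proof (rule nn_integral_cong)
    fix \<xi> assume \<xi>: "\<xi> \<in> space GP"
    have "(\<integral>\<^sup>+\<theta>. ennreal ((0 + ?B \<theta> \<xi>)\<^sup>2) \<partial>GP) = (\<integral>\<^sup>+\<theta>. ennreal (0\<^sup>2) \<partial>GP) +
        (\<Sum>j\<in>J. ennreal (v j) * (\<integral>\<^sup>+\<theta>. ennreal ((A j \<theta> \<xi>)\<^sup>2) \<partial>GP))"
    proof (rule nn_integral_GP_square_row[OF J])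
      show "(\<lambda>\<theta>. A j \<theta> \<xi>) \<in> borel_measurable GP" if "j \<in> J" for j by (rule fixr[OF mA \<xi>]) fact
    qed (auto simp only: A borel_measurable_const)
    then show "(\<integral>\<^sup>+\<theta>. ennreal ((?B \<theta> \<xi>)\<^sup>2) \<partial>GP) =
        (\<Sum>j\<in>J. ennreal (v j) * (\<integral>\<^sup>+\<theta>. ennreal ((A j \<theta> \<xi>)\<^sup>2) \<partial>GP))" by simp
  qed
  also have "\<dots> = (\<Sum>j\<in>J. ennreal (v j) * (\<integral>\<^sup>+\<xi>. \<integral>\<^sup>+\<theta>. ennreal ((A j \<theta> \<xi>)\<^sup>2) \<partial>GP \<partial>GP))"
    by (subst nn_integral_sum, measurable, intro sum.cong refl nn_integral_cmult) measurable
  also have "\<dots> = (\<Sum>j\<in>J. ennreal (v j) * (\<integral>\<^sup>+\<theta>. \<integral>\<^sup>+\<xi>. ennreal ((A j \<theta> \<xi>)\<^sup>2) \<partial>GP \<partial>GP))"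
  proof (intro sum.cong refl arg_cong2[where f="(*)"])
    fix j assume "j \<in> J"
    then show "(\<integral>\<^sup>+\<xi>. \<integral>\<^sup>+\<theta>. ennreal ((A j \<theta> \<xi>)\<^sup>2) \<partial>GP \<partial>GP) =
        (\<integral>\<^sup>+\<theta>. \<integral>\<^sup>+\<xi>. ennreal ((A j \<theta> \<xi>)\<^sup>2) \<partial>GP \<partial>GP)"
      by (intro PP.Fubini') (simp add: case_prod_unfold)
  qed
  finally show ?thesis by (simp add: sum.distrib[symmetric] distrib_left)
qed

section \<open>Relu layers and the count of weights\<close>

lemma dnn_layer_cong:
  assumes "\<And>k i j. k \<le> l \<Longrightarrow> \<theta> (k, i, j) = \<theta>' (k, i, j)"
  shows "dnn_layer d N \<theta> l x = dnn_layer d N \<theta>' l x"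
  using assms by (induction l) auto

lemma relu_square_le: "(relu x)\<^sup>2 \<le> x\<^sup>2"
  by (auto simp: relu_def max_def)

lemma relu_diff_square_le: "(relu x - relu y)\<^sup>2 \<le> (x - y)\<^sup>2"
  unfolding abs_le_square_iff[symmetric] by (auto simp: relu_def)

definition dnn_var :: "nat \<Rightarrow> nat \<Rightarrow> nat \<times> nat \<times> nat \<Rightarrow> real" where
  "dnn_var d N = (\<lambda>(l, i, j). if l = 1 then 1 / real d else 1 / real N)"

definition dnn_width :: "nat \<Rightarrow> nat \<Rightarrow> nat \<Rightarrow> nat \<Rightarrow> nat" where
  "dnn_width d N L l = (if l = 0 then d else dnn_rows N L l)"

lemma dnn_cols_Suc: "Suc l \<le> L \<Longrightarrow> dnn_cols d N (Suc l) = dnn_width d N L l"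
  by (auto simp: dnn_cols_def dnn_width_def dnn_rows_def)

lemma dnn_index_Sigma:
  "dnn_index d N L = (SIGMA l:{1..L}. {..<dnn_rows N L l} \<times> {..<dnn_cols d N l})"
  by (auto simp: dnn_index_def)

lemma card_dnn_index:
  assumes "L \<ge> 2"
  shows "card (dnn_index d N L) = (L - 2) * N\<^sup>2 + N + d * N"
proof -
  have "card (dnn_index d N L) = (\<Sum>l=1..L. dnn_rows N L l * dnn_cols d N l)"
    by (simp add: dnn_index_Sigma)
  \<comment> \<open>\<open>L \<ge> 2\<close> makes layers 1 and L distinct: the first contributes N
    d weights, the last N, and each of the L - 2 others N^2.\<close>
  also have "{1..L} = insert 1 (insert L {2..<L})" using assms by auto
  also have "(\<Sum>l\<in>\<dots>. dnn_rows N L l * dnn_cols d N l) = N * d + (N + (\<Sum>l=2..<L. N * N))"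
    using assms by (auto simp: dnn_rows_def dnn_cols_def intro!: sum.cong)
  finally show ?thesis by (simp add: power2_eq_square mult.commute)
qed

section \<open>The network as an instance of Gaussian prior regression\<close>

locale dnn =
  fixes d N L :: nat and s2 a b :: real
  assumes d: "d \<ge> 1" and N: "N \<ge> 1" and L: "L \<ge> 1" and s2: "s2 > 0"
    and a: "a \<ge> 0" and b: "b > 0" and ab: "a\<^sup>2 + b\<^sup>2 = 1"
begin

sublocale GF: gauss_family "dnn_index d N L" "dnn_var d N"
  by unfold_locales (use d N in \<open>auto simp: dnn_index_Sigma dnn_var_def split: prod.split\<close>)

sublocale XF: gauss_family "{..<d}" "\<lambda>_. 1 :: real"
  by unfold_locales auto

lemma measurable_dnn_layer:
  assumes "l \<le> L" "i < dnn_width d N L l"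
  shows "(\<lambda>z. dnn_layer d N (fst z) l (snd z) i) \<in> borel_measurable (GF.GP \<Otimes>\<^sub>M XF.GP)"
  using assms
proof (induction l arbitrary: i)
  case 0
  then show ?case
    by (auto simp: dnn_width_def intro!: measurable_compose[OF measurable_snd XF.measurable_GP_component])
next
  case (Suc l)
  have "(\<lambda>z. relu (\<Sum>j<dnn_cols d N (Suc l). fst z (Suc l, i, j) * dnn_layer d N (fst z) l (snd z) j)) \<in>
      borel_measurable (GF.GP \<Otimes>\<^sub>M XF.GP)"
    unfolding relu_def
  proof (intro borel_measurable_max borel_measurable_const borel_measurable_sum borel_measurable_times)
    fix j assume j: "j \<in> {..<dnn_cols d N (Suc l)}"
    then show "(\<lambda>z. dnn_layer d N (fst z) l (snd z) j) \<in> borel_measurable (GF.GP \<Otimes>\<^sub>M XF.GP)"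
      using Suc.prems by (intro Suc.IH) (auto simp: dnn_cols_Suc)
    have "(Suc l, i, j) \<in> dnn_index d N L"
      using Suc.prems j by (auto simp: dnn_index_def dnn_width_def)
    then show "(\<lambda>z. fst z (Suc l, i, j)) \<in> borel_measurable (GF.GP \<Otimes>\<^sub>M XF.GP)"
      by (intro measurable_compose[OF measurable_fst GF.measurable_GP_component])
  qed
  then show ?case by simp
qed

sublocale gaussian_prior_regression "dnn_index d N L" "dnn_var d N" XF.GP "dnn_out d N L" s2 a b
proof unfold_locales
  have "(\<lambda>z. dnn_layer d N (fst z) L (snd z) 0) \<in> borel_measurable (GF.GP \<Otimes>\<^sub>M XF.GP)"
    using L by (intro measurable_dnn_layer) (auto simp: dnn_width_def dnn_rows_def)
  then show "(\<lambda>(\<theta>, x). dnn_out d N L \<theta> x) \<in> borel_measurable (GF.GP \<Otimes>\<^sub>M XF.GP)"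
    by (simp add: dnn_out_def case_prod_unfold)
qed (use s2 a b ab in auto)

section \<open>Second moments through the layers\<close>

abbreviation E2 :: "((nat \<times> nat \<times> nat \<Rightarrow> real) \<Rightarrow> (nat \<times> nat \<times> nat \<Rightarrow> real) \<Rightarrow> real) \<Rightarrow> ennreal" where
  "E2 g \<equiv> (\<integral>\<^sup>+\<theta>. \<integral>\<^sup>+\<xi>. ennreal ((g \<theta> \<xi>)\<^sup>2) \<partial>GF.GP \<partial>GF.GP)"

abbreviation u where "u x l i \<theta> \<xi> \<equiv> dnn_layer d N \<theta> l x i"
abbreviation w where "w x l i \<theta> \<xi> \<equiv> dnn_layer d N (mix \<theta> \<xi>) l x i"

lemma a_le_1: "a \<le> 1"
proof (rule power2_le_imp_le)
  have "0 \<le> b\<^sup>2" by simp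
  with ab show "a\<^sup>2 \<le> 1\<^sup>2" unfolding one_power2 by linarith
qed simp

lemma
  assumes "x \<in> space XF.GP" "l \<le> L" "i < dnn_width d N L l"
  shows measurable_u: "(\<lambda>z. u x l i (fst z) (snd z)) \<in> borel_measurable (GF.GP \<Otimes>\<^sub>M GF.GP)"
    and measurable_w: "(\<lambda>z. w x l i (fst z) (snd z)) \<in> borel_measurable (GF.GP \<Otimes>\<^sub>M GF.GP)"
proof -
  have *: "(\<lambda>\<theta>. dnn_layer d N \<theta> l x i) \<in> borel_measurable GF.GP"
    using measurable_compose[OF measurable_Pair2'[OF assms(1)] measurable_dnn_layer[OF assms(2,3)]] by simp
  show "(\<lambda>z. u x l i (fst z) (snd z)) \<in> borel_measurable (GF.GP \<Otimes>\<^sub>M GF.GP)"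
    by (rule measurable_compose[OF measurable_fst *])
  have "(\<lambda>z. mix (fst z) (snd z)) \<in> GF.GP \<Otimes>\<^sub>M GF.GP \<rightarrow>\<^sub>M GF.GP" by measurable
  from measurable_compose[OF this *]
  show "(\<lambda>z. w x l i (fst z) (snd z)) \<in> borel_measurable (GF.GP \<Otimes>\<^sub>M GF.GP)" .
qed

text \<open>Layer l reads only weights of layers up to l. This is the independence from the weights
  of layer l + 1 in the form the row rule expects.\<close>

lemma u_update: "u x l i (\<theta>((Suc l, r) := y)) \<xi> = u x l i \<theta> \<xi>"
  by (rule arg_cong[OF dnn_layer_cong, of _ _ _ "\<lambda>h. h i"]) auto

lemma w_update:
  "w x l i (\<theta>((Suc l, r) := y)) \<xi> = w x l i \<theta> \<xi>"
  "w x l i \<theta> (\<xi>((Suc l, r) := y)) = w x l i \<theta> \<xi>"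
  by (rule arg_cong[OF dnn_layer_cong, of _ _ _ "\<lambda>h. h i"], auto simp: mix_def)+

text \<open>One formula for three uses: (p, q, r) is (1, 0, 0) for the true preactivation, (0, a, b)
  for the mixed one and (1, -a, -b) for their difference.\<close>

lemma E2_row:
  assumes x: "x \<in> space XF.GP" and l: "Suc l \<le> L" and i: "i < dnn_width d N L (Suc l)"
  defines "n \<equiv> dnn_width d N L l"
  shows "E2 (\<lambda>\<theta> \<xi>. \<Sum>j<n. \<theta> (Suc l, i, j) * (p * u x l j \<theta> \<xi> + q * w x l j \<theta> \<xi>) + \<xi> (Suc l, i, j) *
      (r * w x l j \<theta> \<xi>)) =
    ennreal (1 / real n) *
      (\<Sum>j<n. E2 (\<lambda>\<theta> \<xi>. p * u x l j \<theta> \<xi> + q * w x l j \<theta> \<xi>) + E2 (\<lambda>\<theta> \<xi>. r * w x l j \<theta> \<xi>))"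
proof -
  let ?k = "\<lambda>j. (Suc l, i, j)"
  let ?J = "?k ` {..<n}"
  let ?A = "\<lambda>k \<theta> \<xi>. p * u x l (snd (snd k)) \<theta> \<xi> + q * w x l (snd (snd k)) \<theta> \<xi>"
  let ?C = "\<lambda>k \<theta> \<xi>. r * w x l (snd (snd k)) \<theta> \<xi>"
  have n: "n > 0" using d N L l by (auto simp: n_def dnn_width_def dnn_rows_def)
  have J: "?J \<subseteq> dnn_index d N L"
    using l i by (auto simp: dnn_index_def n_def dnn_cols_Suc) (simp add: dnn_width_def)
  have inj: "inj_on ?k {..<n}" by (auto simp: inj_on_def)
  \<comment> \<open>The prior variance is always the reciprocal of the width of the layer below: d
    below layer 1, N below every other. Layer l is not the output layer, since
    \<open>Suc l \<le> L\<close>.\<close>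
  have var: "dnn_var d N (?k j) = 1 / real n" for j
    using l by (auto simp: dnn_var_def n_def dnn_width_def dnn_rows_def)
  have "E2 (\<lambda>\<theta> \<xi>. \<Sum>k\<in>?J. \<theta> k * ?A k \<theta> \<xi> + \<xi> k * ?C k \<theta> \<xi>) =
      (\<Sum>k\<in>?J. ennreal (dnn_var d N k) * (E2 (?A k) + E2 (?C k)))"
  proof (rule GF.nn_integral_GP_square_row2[OF _ J])
    fix k assume "k \<in> ?J"
    then have k: "snd (snd k) < dnn_width d N L l" by (auto simp: n_def)
    note [measurable] = measurable_u[OF x Suc_leD[OF l] k] measurable_w[OF x Suc_leD[OF l] k]
    show "(\<lambda>z. ?A k (fst z) (snd z)) \<in> borel_measurable (GF.GP \<Otimes>\<^sub>M GF.GP)"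
      "(\<lambda>z. ?C k (fst z) (snd z)) \<in> borel_measurable (GF.GP \<Otimes>\<^sub>M GF.GP)"
      by measurable
  next
    fix k m \<theta> \<xi> y assume "m \<in> ?J"
    then obtain j where m: "m = (Suc l, i, j)" by auto
    show "?A k (\<theta>(m := y)) \<xi> = ?A k \<theta> \<xi>" "?A k \<theta> (\<xi>(m := y)) = ?A k \<theta> \<xi>" "?C k \<theta> (\<xi>(m := y)) = ?C k \<theta> \<xi>"
      unfolding m by (simp_all only: u_update w_update)
  qed simp
  also have "\<dots> = (\<Sum>j<n. ennreal (1 / real n) * (E2 (?A (?k j)) + E2 (?C (?k j))))"
    by (subst sum.reindex[OF inj]) (simp only: o_def var)
  finally show ?thesis by (simp add: sum.reindex[OF inj] sum_distrib_left)
qed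

lemma E2_pair:
  assumes "(\<lambda>z. g (fst z) (snd z)) \<in> borel_measurable (GF.GP \<Otimes>\<^sub>M GF.GP)"
  shows "E2 g = (\<integral>\<^sup>+z. ennreal ((g (fst z) (snd z))\<^sup>2) \<partial>(GF.GP \<Otimes>\<^sub>M GF.GP))"
  using assms by (subst GF.P.nn_integral_fst[symmetric]) auto

lemma E2_scale:
  assumes [measurable]: "(\<lambda>z. g (fst z) (snd z)) \<in> borel_measurable (GF.GP \<Otimes>\<^sub>M GF.GP)"
  shows "E2 (\<lambda>\<theta> \<xi>. r * g \<theta> \<xi>) = ennreal (r\<^sup>2) * E2 g"
proof -
  have "E2 (\<lambda>\<theta> \<xi>. r * g \<theta> \<xi>) =
      (\<integral>\<^sup>+z. ennreal (r\<^sup>2) * ennreal ((g (fst z) (snd z))\<^sup>2) \<partial>(GF.GP \<Otimes>\<^sub>M GF.GP))"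
    by (subst E2_pair) (auto simp: power_mult_distrib ennreal_mult)
  also have "\<dots> = ennreal (r\<^sup>2) * E2 g"
    by (subst E2_pair) (auto simp: nn_integral_cmult)
  finally show ?thesis .
qed

text \<open>Pointwise, (g - a h)^2 + b^2 h^2 = a (g - h)^2 + (1 - a)(g^2 + h^2) when a^2 + b^2 = 1.
  So one layer scales the accumulated distance by a and adds fresh error of weight 1 - a.\<close>

lemma E2_combine:
  assumes [measurable]: "(\<lambda>z. g (fst z) (snd z)) \<in> borel_measurable (GF.GP \<Otimes>\<^sub>M GF.GP)"
    "(\<lambda>z. h (fst z) (snd z)) \<in> borel_measurable (GF.GP \<Otimes>\<^sub>M GF.GP)"
  shows "E2 (\<lambda>\<theta> \<xi>. 1 * g \<theta> \<xi> + - a * h \<theta> \<xi>) + E2 (\<lambda>\<theta> \<xi>. - b * h \<theta> \<xi>) =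
    ennreal a * E2 (\<lambda>\<theta> \<xi>. g \<theta> \<xi> - h \<theta> \<xi>) + ennreal (1 - a) * (E2 g + E2 h)"
proof -
  let ?M = "GF.GP \<Otimes>\<^sub>M GF.GP"
  let ?g = "\<lambda>z. g (fst z) (snd z)" and ?h = "\<lambda>z. h (fst z) (snd z)"
  have "E2 (\<lambda>\<theta> \<xi>. 1 * g \<theta> \<xi> + - a * h \<theta> \<xi>) + E2 (\<lambda>\<theta> \<xi>. - b * h \<theta> \<xi>) =
      (\<integral>\<^sup>+z. ennreal ((1 * ?g z + - a * ?h z)\<^sup>2) + ennreal ((- b * ?h z)\<^sup>2) \<partial>?M)"
    by (subst (1 2) E2_pair, measurable, subst nn_integral_add) auto
  also have "\<dots> = (\<integral>\<^sup>+z. ennreal a * ennreal ((?g z - ?h z)\<^sup>2) + ennreal (1 - a) *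
      (ennreal ((?g z)\<^sup>2) + ennreal ((?h z)\<^sup>2)) \<partial>?M)"
  proof (rule nn_integral_cong)
    fix z
    have "(1 * ?g z + - a * ?h z)\<^sup>2 + (- b * ?h z)\<^sup>2 =
        (?g z)\<^sup>2 - 2 * a * ?g z * ?h z + (a\<^sup>2 + b\<^sup>2) * (?h z)\<^sup>2"
      by (simp add: power2_eq_square algebra_simps)
    also have "\<dots> = a * (?g z - ?h z)\<^sup>2 + (1 - a) * ((?g z)\<^sup>2 + (?h z)\<^sup>2)"
      unfolding ab by (simp add: power2_eq_square algebra_simps)
    finally have "ennreal ((1 * ?g z + - a * ?h z)\<^sup>2 + (- b * ?h z)\<^sup>2) =
        ennreal (a * (?g z - ?h z)\<^sup>2 + (1 - a) * ((?g z)\<^sup>2 + (?h z)\<^sup>2))" by simp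
    then show "ennreal ((1 * ?g z + - a * ?h z)\<^sup>2) + ennreal ((- b * ?h z)\<^sup>2) =
        ennreal a * ennreal ((?g z - ?h z)\<^sup>2) + ennreal (1 - a) *
            (ennreal ((?g z)\<^sup>2) + ennreal ((?h z)\<^sup>2))"
      using a a_le_1 by (simp add: ennreal_plus ennreal_mult)
  qed
  also have "\<dots> = ennreal a * E2 (\<lambda>\<theta> \<xi>. g \<theta> \<xi> - h \<theta> \<xi>) + ennreal (1 - a) * (E2 g + E2 h)"
    by (subst (1 2 3) E2_pair, measurable) (simp add: nn_integral_add nn_integral_cmult)
  finally show ?thesis .
qed

definition avg :: "nat \<Rightarrow> (nat \<Rightarrow> ennreal) \<Rightarrow> ennreal" where
  "avg l F = ennreal (1 / real (dnn_width d N L l)) * (\<Sum>j<dnn_width d N L l. F j)"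

lemma width_pos: "l \<le> L \<Longrightarrow> dnn_width d N L l > 0"
  using d N by (auto simp: dnn_width_def dnn_rows_def)

lemma avg_le:
  assumes "\<And>j. j < dnn_width d N L l \<Longrightarrow> F j \<le> K" and "l \<le> L"
  shows "avg l F \<le> K"
proof -
  let ?n = "dnn_width d N L l"
  have n: "?n > 0" by (rule width_pos[OF assms(2)])
  have "(\<Sum>j<?n. F j) \<le> of_nat ?n * K"
    using sum_bounded_above[of "{..<?n}" F K] assms(1) by simp
  then have "avg l F \<le> ennreal (1 / real ?n) * (of_nat ?n * K)"
    unfolding avg_def by (rule mult_left_mono) simp
  also have "\<dots> = ennreal (1 / real ?n * real ?n) * K"
    by (simp only: ennreal_of_nat_eq_real_of_nat mult.assoc[symmetric]) (subst ennreal_mult, auto)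
  finally show ?thesis using n by simp
qed

lemma avg_linear:
  fixes c c' :: ennreal
  shows "avg l (\<lambda>j. c * F j + c' * (F' j + F'' j)) = c * avg l F + c' * (avg l F' + avg l F'')"
proof -
  have "(\<Sum>j\<in>J. c * F j + c' * (F' j + F'' j)) = c * sum F J + c' * (sum F' J + sum F'' J)" for J
    by (simp add: sum.distrib sum_distrib_left distrib_left)
  then show ?thesis unfolding avg_def by (simp only: distrib_left mult_ac)
qed

text \<open>Averages over a layer are the right quantity: with reciprocal-width variances, the
  second moment of every preactivation is the average below it. Relu increases neither squares nor
  squared differences. The fresh error is at most (1 - a)(q + q), whence 2 (1 - a) q per
  layer.\<close>

lemma avg_moments:
  assumes x: "x \<in> space XF.GP" and l: "l \<le> L"
  defines "q \<equiv> avg 0 (\<lambda>j. ennreal ((x j)\<^sup>2))"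
  shows "avg l (\<lambda>j. E2 (u x l j)) \<le> q \<and> avg l (\<lambda>j. E2 (w x l j)) \<le> q \<and>
    avg l (\<lambda>j. E2 (\<lambda>\<theta> \<xi>. u x l j \<theta> \<xi> - w x l j \<theta> \<xi>)) \<le> ennreal (2 * real l * (1 - a)) * q"
  using l
proof (induction l)
  case 0
  then show ?case by (simp add: q_def GF.P.emeasure_space_1) (simp add: avg_def)
next
  case (Suc l)
  let ?n = "dnn_width d N L l"
  have IH: "avg l (\<lambda>j. E2 (u x l j)) \<le> q" "avg l (\<lambda>j. E2 (w x l j)) \<le> q"
    "avg l (\<lambda>j. E2 (\<lambda>\<theta> \<xi>. u x l j \<theta> \<xi> - w x l j \<theta> \<xi>)) \<le> ennreal (2 * real l * (1 - a)) * q"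
    using Suc by auto
  note mu = measurable_u[OF x Suc_leD[OF Suc.prems]] and mw = measurable_w[OF x Suc_leD[OF Suc.prems]]
  have E2_mono: "E2 g \<le> E2 h" if "\<And>\<theta> \<xi>. (g \<theta> \<xi>)\<^sup>2 \<le> (h \<theta> \<xi>)\<^sup>2" for g h
    by (intro nn_integral_mono ennreal_leI that)
  have mix: "mix \<theta> \<xi> (Suc l, i, j) = a * \<theta> (Suc l, i, j) + b * \<xi> (Suc l, i, j)"
    if "i < dnn_width d N L (Suc l)" "j < ?n" for \<theta> \<xi> i j
  proof -
    have "(Suc l, i, j) \<in> dnn_index d N L"
      using that Suc.prems by (simp add: dnn_index_def dnn_cols_Suc) (simp add: dnn_width_def)
    then show ?thesis by (simp add: mix_def)
  qed
  have "E2 (u x (Suc l) i) \<le> q" if i: "i < dnn_width d N L (Suc l)" for i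
  proof -
    have "E2 (u x (Suc l) i) \<le>
        E2 (\<lambda>\<theta> \<xi>. \<Sum>j<?n. \<theta> (Suc l, i, j) * (1 * u x l j \<theta> \<xi> + 0 * w x l j \<theta> \<xi>) + \<xi> (Suc l, i, j) *
        (0 * w x l j \<theta> \<xi>))"
      using Suc.prems by (intro E2_mono) (simp add: relu_square_le dnn_cols_Suc)
    also have "\<dots> = avg l (\<lambda>j. E2 (u x l j))"
      unfolding E2_row[OF x Suc.prems i] by (simp add: avg_def)
    finally show ?thesis using IH by simp
  qed
  moreover have "E2 (w x (Suc l) i) \<le> q" if i: "i < dnn_width d N L (Suc l)" for i
  proof -
    have "E2 (w x (Suc l) i) \<le>
        E2 (\<lambda>\<theta> \<xi>. \<Sum>j<?n. \<theta> (Suc l, i, j) * (0 * u x l j \<theta> \<xi> + a * w x l j \<theta> \<xi>) + \<xi> (Suc l, i, j) *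
        (b * w x l j \<theta> \<xi>))"
    proof (rule E2_mono)
      fix \<theta> \<xi>
      have "(\<Sum>j<?n. mix \<theta> \<xi> (Suc l, i, j) * w x l j \<theta> \<xi>) =
          (\<Sum>j<?n. \<theta> (Suc l, i, j) * (0 * u x l j \<theta> \<xi> + a * w x l j \<theta> \<xi>) + \<xi> (Suc l, i, j) *
          (b * w x l j \<theta> \<xi>))"
        using i by (intro sum.cong refl) (simp add: mix algebra_simps)
      then show "(w x (Suc l) i \<theta> \<xi>)\<^sup>2 \<le>
          (\<Sum>j<?n. \<theta> (Suc l, i, j) * (0 * u x l j \<theta> \<xi> + a * w x l j \<theta> \<xi>) + \<xi> (Suc l, i, j) *
          (b * w x l j \<theta> \<xi>))\<^sup>2"
        using Suc.prems relu_square_le[of "\<Sum>j<?n. mix \<theta> \<xi> (Suc l, i, j) *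
            w x l j \<theta> \<xi>"] by (simp add: dnn_cols_Suc)
    qed
    also have "\<dots> = avg l (\<lambda>j. E2 (w x l j))"
      unfolding E2_row[OF x Suc.prems i] avg_def
    proof (intro arg_cong2[where f="(*)"] sum.cong refl)
      fix j assume "j \<in> {..<?n}"
      then have "j < ?n" by simp
      note s = E2_scale[OF mw[OF this]]
      have "ennreal (a\<^sup>2) * e + ennreal (b\<^sup>2) * e = e" for e
        by (simp add: distrib_right[symmetric] ennreal_plus[symmetric] ab del: ennreal_plus)
      then show "E2 (\<lambda>\<theta> \<xi>. 0 * u x l j \<theta> \<xi> + a * w x l j \<theta> \<xi>) + E2 (\<lambda>\<theta> \<xi>. b * w x l j \<theta> \<xi>) =
          E2 (w x l j)"
        by (simp add: s)
    qed
    finally show ?thesis using IH by simp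
  qed
  moreover have "E2 (\<lambda>\<theta> \<xi>. u x (Suc l) i \<theta> \<xi> - w x (Suc l) i \<theta> \<xi>) \<le>
      ennreal (2 * real (Suc l) * (1 - a)) * q"
    if i: "i < dnn_width d N L (Suc l)" for i
  proof -
    have "E2 (\<lambda>\<theta> \<xi>. u x (Suc l) i \<theta> \<xi> - w x (Suc l) i \<theta> \<xi>) \<le>
        E2 (\<lambda>\<theta> \<xi>. \<Sum>j<?n. \<theta> (Suc l, i, j) * (1 * u x l j \<theta> \<xi> + - a * w x l j \<theta> \<xi>) + \<xi> (Suc l, i, j) *
            (- b * w x l j \<theta> \<xi>))"
    proof (rule E2_mono)
      fix \<theta> \<xi>
      have *: "(\<Sum>j<?n. \<theta> (Suc l, i, j) * u x l j \<theta> \<xi>) - (\<Sum>j<?n. mix \<theta> \<xi> (Suc l, i, j) * w x l j \<theta> \<xi>) =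
         (\<Sum>j<?n. \<theta> (Suc l, i, j) * (1 * u x l j \<theta> \<xi> + - a * w x l j \<theta> \<xi>) + \<xi> (Suc l, i, j) *
             (- b * w x l j \<theta> \<xi>))"
        unfolding sum_subtractf[symmetric] using i by (intro sum.cong refl) (simp add: mix algebra_simps)
      show "(u x (Suc l) i \<theta> \<xi> - w x (Suc l) i \<theta> \<xi>)\<^sup>2 \<le>
          (\<Sum>j<?n. \<theta> (Suc l, i, j) * (1 * u x l j \<theta> \<xi> + - a * w x l j \<theta> \<xi>) + \<xi> (Suc l, i, j) *
          (- b * w x l j \<theta> \<xi>))\<^sup>2"
        unfolding *[symmetric] dnn_layer.simps dnn_cols_Suc[OF Suc.prems] by (rule relu_diff_square_le)
    qed
    also have "\<dots> = avg l (\<lambda>j. ennreal a * E2 (\<lambda>\<theta> \<xi>. u x l j \<theta> \<xi> - w x l j \<theta> \<xi>) + ennreal (1 - a) *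
        (E2 (u x l j) + E2 (w x l j)))"
      unfolding E2_row[OF x Suc.prems i] avg_def
      by (intro arg_cong2[where f="(*)"] sum.cong refl E2_combine mu mw) simp_all
    also have "\<dots> \<le> ennreal a * (ennreal (2 * real l * (1 - a)) * q) + ennreal (1 - a) * (q + q)"
      unfolding avg_linear by (intro add_mono mult_left_mono IH) auto
    \<comment> \<open>The contraction factor a is given up, leaving plain additive growth with
      depth.\<close>
    also have "\<dots> \<le> 1 * (ennreal (2 * real l * (1 - a)) * q) + ennreal (1 - a) * (q + q)"
      using a_le_1 by (intro add_right_mono mult_right_mono) auto
    also have "\<dots> = ennreal (2 * real (Suc l) * (1 - a)) * q"
    proof -
      have "ennreal (2 * real (Suc l) * (1 - a)) =
          ennreal (2 * real l * (1 - a)) + (ennreal (1 - a) + ennreal (1 - a))"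
      proof -
        have "2 * real (Suc l) * (1 - a) = 2 * real l * (1 - a) + ((1 - a) + (1 - a))"
          by (simp add: algebra_simps)
        moreover have "0 \<le> 2 * real l * (1 - a)" "0 \<le> 1 - a" using a_le_1 by simp_all
        ultimately show ?thesis by (simp only: ennreal_plus add_nonneg_nonneg)
      qed
      then show ?thesis by (simp add: algebra_simps)
    qed
    finally show ?thesis .
  qed
  ultimately show ?case using Suc.prems by (intro conjI avg_le) auto
qed

text \<open>The output layer has width 1, so its average is the squared distance of the outputs. At
  the other end, the mean square of the d standard normal input coordinates has expectation
  1.\<close>

lemma distortion_le: "distortion \<le> ennreal (2 * real L * (1 - a))"
proof -
  interpret PX: pair_sigma_finite GF.GP XF.GP ..
  let ?c = "ennreal (2 * real L * (1 - a))"
  let ?q = "\<lambda>x. avg 0 (\<lambda>j. ennreal ((x j)\<^sup>2))"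
  have [measurable]: "(\<lambda>x. x j) \<in> borel_measurable XF.GP" if "j < dnn_width d N L 0" for j
    using that by (intro XF.measurable_GP_component) (auto simp: dnn_width_def)
  have "distortion = (\<integral>\<^sup>+x. E2 (\<lambda>\<theta> \<xi>. u x L 0 \<theta> \<xi> - w x L 0 \<theta> \<xi>) \<partial>XF.GP)"
    unfolding distortion_def
    by (subst PX.Fubini') (auto simp: dnn_out_def[symmetric])
  also have "\<dots> \<le> (\<integral>\<^sup>+x. ?c * ?q x \<partial>XF.GP)"
  proof (rule nn_integral_mono)
    fix x assume x: "x \<in> space XF.GP"
    have "dnn_width d N L L = 1" using L by (simp add: dnn_width_def dnn_rows_def)
    then show "E2 (\<lambda>\<theta> \<xi>. u x L 0 \<theta> \<xi> - w x L 0 \<theta> \<xi>) \<le> ?c * ?q x"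
      using avg_moments[OF x order_refl] by (simp add: avg_def[of L])
  qed
  also have "\<dots> = ?c * avg 0 (\<lambda>j. \<integral>\<^sup>+x. ennreal ((x j)\<^sup>2) \<partial>XF.GP)"
  proof -
    have "(\<integral>\<^sup>+x. (\<Sum>j<dnn_width d N L 0. ennreal ((x j)\<^sup>2)) \<partial>XF.GP) =
        (\<Sum>j<dnn_width d N L 0. \<integral>\<^sup>+x. ennreal ((x j)\<^sup>2) \<partial>XF.GP)"
      by (rule nn_integral_sum) simp
    then show ?thesis unfolding avg_def by (simp add: nn_integral_cmult del: sum_ennreal)
  qed
  also have "\<dots> \<le> ?c * 1"
  proof (intro mult_left_mono avg_le)
    fix j assume "j < dnn_width d N L 0"
    then show "(\<integral>\<^sup>+x. ennreal ((x j)\<^sup>2) \<partial>XF.GP) \<le> 1"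
      using XF.nn_integral_GP_component[of j "\<lambda>y. ennreal (y\<^sup>2)"] nn_integral_gauss_square[of 1 0 1]
      by (simp add: dnn_width_def)
  qed auto
  finally show ?thesis by simp
qed

end

section \<open>The error bound\<close>

text \<open>Only the sigma-algebra of S enters. This bridges Borel products, over which the
  conditional laws are given, and products of Gaussian measures, over which they are
  computed.\<close>

lemma is_cond_distr_cong_sets:
  assumes "sets S = sets S'" and "is_cond_distr M S Z Y K"
  shows "is_cond_distr M S' Z Y K"
  using assms by (simp add: is_cond_distr_def measurable_cong_sets[OF assms(1) refl]
      distr_cong[OF refl assms(1) refl])

text \<open>As a^2 \<le> a, the factor 1 - a is at most b^2, so the total cost is at most P/2 times
  (y b^2 - ln b^2). This is minimal at b^2 = 1/y; the choice 1/(1 + y) keeps b below 1 for every y,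
  and the first term is still at most P/2.\<close>

lemma mixing_weight_bound:
  fixes P s2 a b y :: real and L T :: nat
  assumes P: "P > 0" and s2: "s2 > 0" and L: "L \<ge> 1" and T: "T \<ge> 1"
  defines "y \<equiv> 2 * real L * real T / (s2 * P)"
  defines "a \<equiv> sqrt (y / (1 + y))" and "b \<equiv> 1 / sqrt (1 + y)"
  shows "0 \<le> a" "0 < b" "a\<^sup>2 + b\<^sup>2 = 1"
    and "real T * (2 * real L * (1 - a)) / (2 * s2) - P * ln b \<le> P / 2 * (1 + ln (1 + y))"
proof -
  have y: "y > 0" using P s2 L T by (simp add: y_def)
  then show "0 \<le> a" "0 < b" by (simp_all add: a_def b_def)
  show 1: "a\<^sup>2 + b\<^sup>2 = 1" using y by (simp add: a_def b_def power_divide add_divide_distrib[symmetric])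
  have b2: "b\<^sup>2 = 1 / (1 + y)" using y by (simp add: b_def power_divide)
  have "a \<le> 1" using y by (simp add: a_def)
  then have "a\<^sup>2 \<le> a" using \<open>0 \<le> a\<close> by (simp add: power2_eq_square mult_left_le)
  then have "1 - a \<le> 1 / (1 + y)" using 1 b2 by simp
  then have "real T * (2 * real L * (1 - a)) / (2 * s2) \<le>
      real T * (2 * real L * (1 / (1 + y))) / (2 * s2)"
    using s2 by (intro divide_right_mono mult_left_mono) auto
  also have "\<dots> = P / 2 * (y / (1 + y))"
  proof -
    have "real L * real T / s2 = P * y / 2" using P s2 by (simp add: y_def)
    moreover have "real T * (2 * real L * (1 / (1 + y))) / (2 * s2) = real L * real T / s2 / (1 + y)"
      by (simp add: mult.commute)
    ultimately show ?thesis by (simp only:) simp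
  qed
  also have "\<dots> \<le> P / 2 * 1"
    using P y by (intro mult_left_mono) auto
  finally have "real T * (2 * real L * (1 - a)) / (2 * s2) \<le> P / 2" by simp
  moreover have "ln b = - ln (1 + y) / 2"
    using y by (simp add: b_def ln_div ln_sqrt)
  ultimately show "real T * (2 * real L * (1 - a)) / (2 * s2) - P * ln b \<le> P / 2 * (1 + ln (1 + y))"
    by (simp add: algebra_simps)
qed

theorem mainTheorem10:
  fixes d N L T :: nat and s2 :: real
    and K1 :: "nat \<Rightarrow> (nat \<times> nat \<times> nat \<Rightarrow> real) \<times> dnn_hist \<Rightarrow> real measure"
    and K2 :: "nat \<Rightarrow> dnn_hist \<Rightarrow> real measure"
  assumes "d \<ge> 1" and "N \<ge> 1" and "L \<ge> 2" and "s2 > 0" and "T \<ge> 1"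
    and K1: "\<And>t. is_cond_distr (dnn_space d N L s2) (theta_space d N L \<Otimes>\<^sub>M hist_space d t)
                 (\<lambda>\<omega>. (dnn_theta \<omega>, dnn_H d N L t \<omega>)) (dnn_Y d N L (Suc t)) (K1 t)"
    and K2: "\<And>t. is_cond_distr (dnn_space d N L s2) (hist_space d t)
                 (dnn_H d N L t) (dnn_Y d N L (Suc t)) (K2 t)"
  shows "(\<Sum>t<T. \<integral>\<^sup>+ \<omega>. ennreal (dKL (K1 t (dnn_theta \<omega>, dnn_H d N L t \<omega>))
                                      (K2 t (dnn_H d N L t \<omega>))) \<partial>dnn_space d N L s2)
           / ennreal (real T)
         \<le> ennreal (let P = real (L - 2) * real N ^ 2 + real N + real d * real N
                    in P / (2 * real T) * (1 + ln (1 + 2 * real L * real T / (s2 * P))))"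
proof -
  define P where "P = real (L - 2) * real N ^ 2 + real N + real d * real N"
  define y where "y = 2 * real L * real T / (s2 * P)"
  define a where "a = sqrt (y / (1 + y))"
  define b where "b = 1 / sqrt (1 + y)"
  have P: "P > 0"
    unfolding P_def using \<open>N \<ge> 1\<close> by (intro add_pos_nonneg add_nonneg_pos) auto
  have card: "real (card (dnn_index d N L)) = P"
    using card_dnn_index[OF \<open>L \<ge> 2\<close>, of d N] by (simp add: P_def)
  note ab = mixing_weight_bound[OF P \<open>s2 > 0\<close> _ \<open>T \<ge> 1\<close>, of L, folded y_def, folded a_def b_def]
  interpret D: dnn d N L s2 a b
    by unfold_locales (use assms ab in auto)
  have prior: "dnn_prior d N L = D.GF.GP"
    unfolding dnn_prior_def dnn_var_def by (intro arg_cong2[where f=PiM] refl) (auto simp: fun_eq_iff)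
  have Om: "dnn_space d N L s2 = D.Om"
    unfolding dnn_space_def prior ..
  have H: "dnn_H d N L t = D.H t" and Y: "dnn_Y d N L s = D.Y s" and \<theta>: "dnn_theta = fst" for t s
    by (auto simp: fun_eq_iff dnn_H_def D.H_def dnn_Y_def D.Y_def dnn_theta_def dnn_X_def dnn_W_def restrict_def)
  have hist: "sets (hist_space d t) = sets (D.HS t)" for t
    unfolding hist_space_def One_nat_def
    by (intro sets_pair_measure_cong sets_PiM_cong refl) simp
  have theta: "sets (theta_space d N L) = sets D.GF.GP"
    unfolding theta_space_def by (intro sets_PiM_cong refl) simp
  have C1: "is_cond_distr D.Om (D.GF.GP \<Otimes>\<^sub>M D.HS t) (\<lambda>\<omega>. (fst \<omega>, D.H t \<omega>)) (D.Y (Suc t)) (K1 t)" for t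
    using K1[of t] unfolding Om H Y \<theta>
    by (rule is_cond_distr_cong_sets[OF sets_pair_measure_cong[OF theta hist]])
  have C2: "is_cond_distr D.Om (D.HS t) (D.H t) (D.Y (Suc t)) (K2 t)" for t
    using K2[of t] unfolding Om H Y by (rule is_cond_distr_cong_sets[OF hist])
  have "(\<Sum>t<T. \<integral>\<^sup>+\<omega>. ennreal (dKL (K1 t (fst \<omega>, D.H t \<omega>)) (K2 t (D.H t \<omega>))) \<partial>D.Om) \<le>
      ennreal (real T * (2 * real L * (1 - a)) / (2 * s2) - card (dnn_index d N L) * ln b)"
    using D.a_le_1 by (intro D.sum_expected_dKL_le C1 C2 D.distortion_le) simp
  also have "\<dots> \<le> ennreal (P / 2 * (1 + ln (1 + y)))"
    unfolding card by (intro ennreal_leI ab) (use \<open>L \<ge> 2\<close> in simp)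
  finally have "(\<Sum>t<T. \<integral>\<^sup>+\<omega>. ennreal (dKL (K1 t (fst \<omega>, D.H t \<omega>)) (K2 t (D.H t \<omega>))) \<partial>D.Om) / ennreal (real T)
      \<le> ennreal (P / 2 * (1 + ln (1 + y))) / ennreal (real T)"
    by (rule divide_right_mono_ennreal)
  also have "\<dots> = ennreal (P / (2 * real T) * (1 + ln (1 + y)))"
  proof -
    \<comment> \<open>With y nonnegative the logarithm is nonnegative, hence so is the bound, and
      division by T may be moved inside \<open>ennreal\<close>.\<close>
    have "y \<ge> 0" using P assms by (simp add: y_def)
    then show ?thesis using P assms by (subst divide_ennreal) auto
  qed
  finally show ?thesis
    unfolding Om H \<theta> Let_def P_def[symmetric] y_def[symmetric] .
qed

end
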